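(* Let $m\ge2$ be an integer and put $n=2^{2m}+1$. Let $\theta\in\mathbb F_{2^{4m}}\setminus\mathbb F_{2^{2m}}$ be an element of multiplicative order $2^{2m}+1$, and let $g(x)\in\mathbb F_2[x]$ be the minimal polynomial of $\theta$ over $\mathbb F_2$. Let $\mathcal C\subseteq\mathbb F_2^n$ be the cyclic code of length $n$ with generator polynomial $g(x)$, and let $\mathcal O\subseteq\mathbb F_2^n$ be the Euclidean dual of $\mathcal C$. Then $\mathcal O$ is a binary orthogonal array of cardinality $M=2^{4m}$ and strength $\tau=4$, and its covering radius satisfies $$R(\mathcal O)\ge2^{2m-1}-2^m+1.$$
   Context: A code $C\subset\mathbb F_2^n$ with $M=|C|$ is a binary orthogonal array of strength $\tau$ if in the $M\times n$ matrix whose rows are the codewords, every $M\times\tau$ submatrix contains every element of $\mathbb F_2^\tau$ as a row exactly $M/2^\tau$ times. For linear $C$ the strength is $\tau=d^\perp-1$, where $d^\perp$ is the minimum distance of the dual code $C^\perp$. The covering radius is $R(C)=\max_{y\in\mathbb F_2^n}\min_{x\in C}d(x,y)$, with $d$ the Hamming distance. The cyclic code of length $n$ with generator polynomial $g$ is the set of coefficient vectors of the polynomials of degree less than $n$ over $\mathbb F_2$ that are multiples of $g$ (modulo $x^n-1$). The Euclidean dual is with respect to the standard inner product on $\mathbb F_2^n$. *)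

theory Defs
  imports
    Complex_Main
    "HOL-Library.Z2"
    "HOL-Library.Cardinality"
    "HOL-Computational_Algebra.Polynomial"
    "HOL-Number_Theory.Cong"
    "Jordan_Normal_Form.Matrix"
begin

text \<open>
  The binary field is the type \<^typ>\<open>bit\<close>, and the vector space of binary words of length \<open>n\<close>
  is \<^term>\<open>carrier_vec n :: bit vec set\<close>, with coordinates numbered from \<open>0\<close> to \<open>n - 1\<close>.
  Extension fields are field types; \<^term>\<open>of_bit\<close> is the inclusion of the binary field, and it is
  a ring homomorphism exactly when the field has characteristic \<open>2\<close>.
\<close>

definition is_subfield :: "'a::field set \<Rightarrow> bool" where
  "is_subfield K \<longleftrightarrow>
     0 \<in> K \<and> 1 \<in> K \<and>
     (\<forall>x\<in>K. \<forall>y\<in>K. x + y \<in> K \<and> x * y \<in> K) \<and>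
     (\<forall>x\<in>K. - x \<in> K \<and> inverse x \<in> K)"

definition has_mult_order :: "'a::field \<Rightarrow> nat \<Rightarrow> bool" where
  "has_mult_order x N \<longleftrightarrow> 0 < N \<and> x ^ N = 1 \<and> (\<forall>k. 0 < k \<and> k < N \<longrightarrow> x ^ k \<noteq> 1)"

definition is_binary_min_poly :: "'a::field \<Rightarrow> bit poly \<Rightarrow> bool" where
  "is_binary_min_poly x g \<longleftrightarrow>
     lead_coeff g = 1 \<and> poly (map_poly of_bit g) x = 0 \<and>
     (\<forall>q. q \<noteq> 0 \<and> poly (map_poly of_bit q) x = 0 \<longrightarrow> degree g \<le> degree q)"

text \<open>For \<open>n > 0\<close>; the zero polynomial has degree \<open>0\<close>, so it is included.\<close>

definition cyclic_code :: "nat \<Rightarrow> bit poly \<Rightarrow> bit vec set" where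
  "cyclic_code n g =
     {vec n (coeff p) | p. degree p < n \<and> (\<exists>q. [p = g * q] (mod (monom 1 n - 1)))}"

definition euclidean_dual :: "nat \<Rightarrow> bit vec set \<Rightarrow> bit vec set" where
  "euclidean_dual n C = {y \<in> carrier_vec n. \<forall>x\<in>C. x \<bullet> y = 0}"

text \<open>A choice of \<open>\<tau>\<close> columns is a set \<open>T\<close> of \<open>\<tau>\<close> coordinates, and only the values of \<open>v\<close> on \<open>T\<close>
  matter. The division is in the reals, so divisibility of the cardinality by the power of \<open>2\<close> is
  part of the condition.\<close>

definition binary_orthogonal_array :: "nat \<Rightarrow> nat \<Rightarrow> bit vec set \<Rightarrow> bool" where
  "binary_orthogonal_array n \<tau> C \<longleftrightarrow>
     C \<subseteq> carrier_vec n \<and> \<tau> \<le> n \<and>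
     (\<forall>T v. T \<subseteq> {..<n} \<and> card T = \<tau> \<longrightarrow>
        real (card {c \<in> C. \<forall>i\<in>T. c $ i = v i}) = real (card C) / 2 ^ \<tau>)"

text \<open>An orthogonal array of strength \<open>\<tau>\<close> is also one of every smaller strength; the strength of a
  code is the largest one, which for a linear code is the dual minimum distance minus \<open>1\<close>.\<close>

definition oa_strength :: "nat \<Rightarrow> bit vec set \<Rightarrow> nat" where
  "oa_strength n C = Max {\<tau>. binary_orthogonal_array n \<tau> C}"

definition hamming_dist :: "nat \<Rightarrow> bit vec \<Rightarrow> bit vec \<Rightarrow> nat" where
  "hamming_dist n x y = card {i. i < n \<and> x $ i \<noteq> y $ i}"

text \<open>Meaningful for nonempty \<open>C\<close>, where both extrema are over finite nonempty sets.\<close>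

definition covering_radius :: "nat \<Rightarrow> bit vec set \<Rightarrow> nat" where
  "covering_radius n C =
     Max ((\<lambda>y. Min ((\<lambda>x. hamming_dist n x y) ` C)) ` carrier_vec n)"

end

theory Submission
  imports Defs "HOL-Computational_Algebra.Primes"
begin

text \<open>
  Put \<open>q = 2 ^ (2 * m)\<close>, let \<open>K\<close> be the subfield with \<open>q\<close> elements and \<open>U\<close> the group of the powers of
  \<open>\<theta>\<close>, that is, of the elements of norm \<open>1\<close> over \<open>K\<close>. The code \<open>\<O>\<close> consists of the words
  \<open>(Tr (a \<theta>\<^sup>i))\<^sub>i\<close>. Its strength is \<open>4\<close> because one to four distinct elements of \<open>U\<close> never sum to \<open>0\<close>
  while some five do.

  For the covering radius take the all-ones word. Its distance to the word of \<open>a\<close> is the number of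
  \<open>u \<in> U\<close> with \<open>Tr (a u) = 0\<close>. With \<open>u + 1 / u = z\<close> this number becomes a Kloosterman count over \<open>K\<close>, and
  the bound is the Hasse inequality for \<open>Y\<^sup>2 + X Y = X\<^sup>3 + c\<^sup>2\<close>. The latter is proved in Manin's way:
  over the rational functions in \<open>x\<close>, let \<open>P\<close> be the generic point of the curve and \<open>Q\<close> its Frobenius image;
  the heights \<open>h\<^sub>n\<close> of the abscissas of \<open>Q + n P\<close> satisfy \<open>h\<^sub>n\<^sub>+\<^sub>1 + h\<^sub>n\<^sub>-\<^sub>1 \<le> 2 h\<^sub>n + 2\<close>, so
  that \<open>h\<^sub>n\<close> is at most a quadratic polynomial in \<open>n\<close>, which therefore is nonnegative at \<open>n = \<surd>q\<close>.
\<close>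

section \<open>Manin's height recursion in characteristic two\<close>

lemma two_eq_0_CHAR_2: "CHAR('a::comm_ring_1) = 2 \<Longrightarrow> (2::'a) = 0"
  using of_nat_CHAR[where 'a='a] by simp

lemma CHAR_2_poly: "CHAR('a::comm_ring_1) = 2 \<Longrightarrow> CHAR('a poly) = 2"
  by simp

text \<open>Coprimality as an explicit Bezout identity, so that ideal membership arguments apply
  directly.\<close>

definition comaximal :: "'a::comm_ring_1 \<Rightarrow> 'a \<Rightarrow> bool" where
  "comaximal a b \<longleftrightarrow> (\<exists>u v. u * a + v * b = 1)"

lemma comaximal_sym: "comaximal a b \<Longrightarrow> comaximal b a"
  unfolding comaximal_def by (metis add.commute)

text \<open>Multiply \<open>c\<close> by the square of the Bezout identity: modulo \<open>b\<close>
  only a multiple of \<open>c * a^2\<close> survives.\<close>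

lemma comaximal_dvd_mult_power2:
  assumes "comaximal a b" "b dvd c * a\<^sup>2"
  shows "b dvd c"
proof -
  obtain u v where uv: "u * a + v * b = 1"
    using assms(1) by (auto simp: comaximal_def)
  have "c = c * (u * a + v * b)\<^sup>2"
    by (simp add: uv)
  also have "\<dots> = u\<^sup>2 * (c * a\<^sup>2) + b * (c * (2 * u * a * v + v\<^sup>2 * b))"
    by (simp add: algebra_simps power2_eq_square)
  finally show ?thesis
    using assms(2) by (metis dvd_add dvd_mult dvd_triv_left)
qed

text \<open>A nonzero element of least degree in the ideal generated by \<open>f\<close> and
  \<open>g\<close> divides both, and dividing its Bezout representation by it makes the cofactors
  comaximal.\<close>

lemma poly_bezout:
  fixes f g :: "'a::field poly"
  assumes "f \<noteq> 0 \<or> g \<noteq> 0"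
  obtains d u v f' g' where "d \<noteq> 0" "f = d * f'" "g = d * g'" "u * f' + v * g' = 1"
proof -
  define I where "I = {h. h \<noteq> 0 \<and> (\<exists>u v. h = u * f + v * g)}"
  have "f = 1 * f + 0 * g" "g = 0 * f + 1 * g" by simp_all
  then have "\<exists>h. h \<in> I" using assms unfolding I_def by blast
  then obtain d where d: "d \<in> I" and min: "\<And>h. h \<in> I \<Longrightarrow> degree d \<le> degree h"
    using ex_has_least_nat[of "\<lambda>h. h \<in> I" _ degree] by blast
  then obtain u v where uv: "d = u * f + v * g" and d0: "d \<noteq> 0"
    by (auto simp: I_def)
  have dvd: "d dvd h" if "h = a * f + b * g" for h a b
  proof (rule ccontr)
    assume nd: "\<not> d dvd h"
    then have nz: "h mod d \<noteq> 0" by (simp add: dvd_eq_mod_eq_0)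
    have "h mod d = h - h div d * d" by (simp add: minus_div_mult_eq_mod)
    also have "\<dots> = (a - h div d * u) * f + (b - h div d * v) * g"
      unfolding uv that by (simp add: algebra_simps)
    finally have "h mod d \<in> I" using nz unfolding I_def by blast
    from min[OF this] show False
      using degree_mod_less[OF d0, of h] nz by simp
  qed
  obtain f' where f': "f = d * f'" using dvd[of f 1 0] by auto
  obtain g' where g': "g = d * g'" using dvd[of g 0 1] by auto
  have "d * (u * f' + v * g') = u * f + v * g"
    unfolding f' g' by (simp add: algebra_simps)
  then have "d * (u * f' + v * g') = d * 1" by (simp flip: uv)
  then have "u * f' + v * g' = 1" using d0 by (metis mult_cancel_left)
  then show ?thesis using that d0 f' g' by blast
qed

text \<open>A form \<open>A T^2 + B T S + C S^2\<close> vanishing at \<open>(f, g)\<close> is the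
  product of \<open>g T - f S\<close> and \<open>g' T - f' S\<close>. Comaximality puts the second
  factor over the ring itself: reducing the equation modulo \<open>g\<close> and modulo
  \<open>f\<close> shows that \<open>g\<close> divides \<open>A\<close> and \<open>f\<close> divides
  \<open>C\<close>.\<close>

lemma comaximal_factor_binary_quadratic_form:
  fixes f g A B C :: "'a::idom"
  assumes cm: "comaximal f g" and root: "A * f\<^sup>2 + B * f * g + C * g\<^sup>2 = 0"
  obtains f' g' where "A = g * g'" "B = - (f * g' + f' * g)" "C = f * f'"
proof -
  obtain u v where uv: "u * f + v * g = 1"
    using cm by (auto simp: comaximal_def)
  show ?thesis
  proof (cases "f = 0 \<or> g = 0")
    case True
    then show ?thesis
    proof
      assume f: "f = 0"
      then have v: "g * v = 1" using uv by (simp add: mult.commute)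
      then have "g \<noteq> 0" by auto
      with root f have "C = 0" by simp
      moreover have "A = g * (v * A)" "B = - (f * (v * A) + - (v * B) * g)"
        using v f by (simp_all add: algebra_simps flip: mult.assoc)
      ultimately show ?thesis using f that[of "v * A" "- (v * B)"] by simp
    next
      assume g: "g = 0"
      then have u: "f * u = 1" using uv by (simp add: mult.commute)
      then have "f \<noteq> 0" by auto
      with root g have "A = 0" by simp
      moreover have "C = f * (u * C)" "B = - (f * (- (u * B)) + u * C * g)"
        using u g by (simp_all add: algebra_simps flip: mult.assoc)
      ultimately show ?thesis using g that[of "- (u * B)" "u * C"] by simp
    qed
  next
    case False
    have "A * f\<^sup>2 + g * (B * f + C * g) = 0"
      using root by (simp add: algebra_simps power2_eq_square)
    then have "A * f\<^sup>2 = g * (- (B * f + C * g))"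
      unfolding mult_minus_right by (simp only: eq_neg_iff_add_eq_0)
    then have "g dvd A" using comaximal_dvd_mult_power2[OF cm] by (metis dvd_triv_left)
    then obtain g' where g': "A = g * g'" by auto
    have "C * g\<^sup>2 + f * (A * f + B * g) = 0"
      using root by (simp add: algebra_simps power2_eq_square)
    then have "C * g\<^sup>2 = f * (- (A * f + B * g))"
      unfolding mult_minus_right by (simp only: eq_neg_iff_add_eq_0)
    then have "f dvd C" using comaximal_dvd_mult_power2[OF comaximal_sym[OF cm]]
      by (metis dvd_triv_left)
    then obtain f' where f': "C = f * f'" by auto
    have "(f * g) * (B + (f * g' + f' * g)) = 0"
      using root unfolding f' g' by (simp add: algebra_simps power2_eq_square)
    then have "B = - (f * g' + f' * g)"
      using False eq_neg_iff_add_eq_0 by (metis mult_eq_0_iff)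
    then show ?thesis using that g' f' by blast
  qed
qed

lemma coeff_mult_degree_bounds:
  fixes p q :: "'a::comm_semiring_0 poly"
  assumes "degree p \<le> a" "degree q \<le> b"
  shows "coeff (p * q) (a + b) = coeff p a * coeff q b"
proof (cases "degree p = a \<and> degree q = b")
  case True
  then show ?thesis using coeff_mult_degree_sum by metis
next
  case False
  then have "degree p < a \<or> degree q < b" using assms by auto
  then have "degree (p * q) < a + b" "coeff p a * coeff q b = 0"
    using degree_mult_le[of p q] assms by (auto simp: coeff_eq_0)
  then show ?thesis by (simp add: coeff_eq_0)
qed

text \<open>For comaximal arguments this is the degree of \<open>f / g\<close> as a rational
  function.\<close>

definition height :: "'a::zero poly \<Rightarrow> 'a poly \<Rightarrow> nat" where
  "height f g = max (degree f) (degree g)"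

lemma coeff_height_nonzero:
  "f \<noteq> 0 \<or> g \<noteq> 0 \<Longrightarrow> coeff f (height f g) \<noteq> 0 \<or> coeff g (height f g) \<noteq> 0"
  unfolding height_def
  by (metis degree_0 leading_coeff_0_iff max_0L max_0R max_def)

text \<open>The factors are the linear forms \<open>g T + f\<close> and \<open>g' T + f'\<close>.\<close>

lemma height_add_le_of_product:
  fixes f g f' g' :: "'a::idom poly"
  assumes "f \<noteq> 0 \<or> g \<noteq> 0" "f' \<noteq> 0 \<or> g' \<noteq> 0"
    and "degree (f * f') \<le> N" "degree (f * g' + f' * g) \<le> N" "degree (g * g') \<le> N"
  shows "height f g + height f' g' \<le> N"
proof -
  define a b where "a = height f g" and "b = height f' g'"
  have deg: "degree f \<le> a" "degree g \<le> a" "degree f' \<le> b" "degree g' \<le> b"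
    by (auto simp: a_def b_def height_def)
  have c1: "coeff (f * f') (a + b) = coeff f a * coeff f' b"
    by (rule coeff_mult_degree_bounds[OF deg(1,3)])
  have c2: "coeff (g * g') (a + b) = coeff g a * coeff g' b"
    by (rule coeff_mult_degree_bounds[OF deg(2,4)])
  have c3: "coeff (f * g' + f' * g) (a + b) = coeff f a * coeff g' b + coeff g a * coeff f' b"
    using coeff_mult_degree_bounds[OF deg(1,4)] coeff_mult_degree_bounds[OF deg(2,3)]
    by (simp add: mult.commute)
  have "coeff f a \<noteq> 0 \<or> coeff g a \<noteq> 0" "coeff f' b \<noteq> 0 \<or> coeff g' b \<noteq> 0"
    using coeff_height_nonzero assms(1,2) by (auto simp: a_def b_def)
  \<comment> \<open>These are the coefficients of a product of two nonzero linear forms over the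
    coefficient domain, so they cannot all vanish.\<close>
  then have "coeff (f * f') (a + b) \<noteq> 0 \<or> coeff (g * g') (a + b) \<noteq> 0
      \<or> coeff (f * g' + f' * g) (a + b) \<noteq> 0"
    unfolding c1 c2 c3 by auto
  then show ?thesis
    using assms(3-5) le_degree unfolding a_def b_def by (metis le_trans)
qed

text \<open>
  The fractions \<open>f / g\<close> and \<open>f' / g'\<close> are the abscissas of two points differing by \<open>P\<close>, on the curve with
  constant term \<open>b\<close>, exactly when this polynomial vanishes. For fixed \<open>f / g\<close> its two roots belong to the two
  neighbours in the sequence \<open>Q + n P\<close>; by symmetry one can walk along the sequence without the group law.
\<close>

definition biq :: "'a::comm_ring_1 \<Rightarrow> 'a poly \<Rightarrow> 'a poly \<Rightarrow> 'a poly \<Rightarrow> 'a poly \<Rightarrow> 'a poly" where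
  "biq b f g f' g' = f\<^sup>2 * f'\<^sup>2 + [:0, 1:]\<^sup>2 * (f\<^sup>2 * g'\<^sup>2 + f'\<^sup>2 * g\<^sup>2)
     + [:0, 1:] * f * g * f' * g' + [:b:] * g\<^sup>2 * g'\<^sup>2"

lemma biq_sym: "biq b f g f' g' = biq b f' g' f g"
  unfolding biq_def by (simp add: algebra_simps)

lemma biq_scale: "biq b f g (d * f') (d * g') = d\<^sup>2 * biq b f g f' g'"
  unfolding biq_def by (simp add: algebra_simps power2_eq_square)

text \<open>Vieta jumping: for fixed \<open>f / g\<close> the polynomial is a quadratic form in the
  other pair, and splitting off the known root leaves the other one. The coefficients of the form
  have degree at most \<open>2 * height f g + 2\<close>, which bounds the sum of the heights of the
  two roots.\<close>

lemma biq_step: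
  fixes f g f' g' :: "'a::field poly"
  assumes char: "CHAR('a) = 2" and b: "b \<noteq> 0"
    and cm: "comaximal f g" "comaximal f' g'" and biq: "biq b f g f' g' = 0"
  obtains f'' g'' where "comaximal f'' g''" "biq b f g f'' g'' = 0"
    "height f' g' + height f'' g'' \<le> 2 * height f g + 2"
proof -
  have two: "(2::'a poly) = 0" using two_eq_0_CHAR_2[OF CHAR_2_poly[OF char]] .
  have sq: "(p + q)\<^sup>2 = p\<^sup>2 + q\<^sup>2" for p q :: "'a poly"
    using two by (simp add: power2_sum)
  define x where "x = [:0, 1::'a:]"
  define A where "A = (f + x * g)\<^sup>2"
  define B where "B = x * f * g"
  define C where "C = x\<^sup>2 * f\<^sup>2 + [:b:] * g\<^sup>2"
  have form: "biq b f g T S = A * T\<^sup>2 + B * T * S + C * S\<^sup>2" for T S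
    unfolding biq_def A_def B_def C_def x_def[symmetric] sq
    by (simp add: algebra_simps power2_eq_square)
  obtain f'' g'' where A: "A = g' * g''" and B: "B = f' * g'' + f'' * g'" and C: "C = f' * f''"
    using comaximal_factor_binary_quadratic_form[OF cm(2)] biq form
      uminus_CHAR_2[OF CHAR_2_poly[OF char]] by metis
  obtain u v where uv: "u * f + v * g = 1" using cm(1) by (auto simp: comaximal_def)
  define b' where "b' = [:inverse b:]"
  have b': "b' * [:b:] = 1" using b by (simp add: b'_def one_pCons)
  \<comment> \<open>The two copies of \<open>x^2 f^2 g^2\<close> cancel in characteristic 2, and for
    \<open>g ^ 4\<close> the constant \<open>b\<close> is a unit. The eighth power is taken below
    because it is additive and each of its two terms is a multiple of \<open>f ^ 4\<close> or of
    \<open>g ^ 4\<close>.\<close>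
  have f4: "f ^ 4 = A * f\<^sup>2 + B\<^sup>2"
  proof -
    have "A * f\<^sup>2 + B\<^sup>2 = f ^ 4 + 2 * (x\<^sup>2 * f\<^sup>2 * g\<^sup>2)"
      unfolding A_def B_def sq by (simp add: algebra_simps power2_eq_square power4_eq_xxxx)
    then show ?thesis using two by simp
  qed
  have g4: "g ^ 4 = b' * (C * g\<^sup>2 + B\<^sup>2)"
  proof -
    have "C * g\<^sup>2 + B\<^sup>2 = [:b:] * g ^ 4 + 2 * (x\<^sup>2 * f\<^sup>2 * g\<^sup>2)"
      unfolding B_def C_def by (simp add: algebra_simps power2_eq_square power4_eq_xxxx)
    then have "b' * (C * g\<^sup>2 + B\<^sup>2) = (b' * [:b:]) * g ^ 4"
      using two by (simp only: mult_zero_left add_0_right mult.assoc)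
    then show ?thesis by (simp only: b' mult_1_left)
  qed
  \<comment> \<open>The ideal generated by \<open>f''\<close> and \<open>g''\<close> contains \<open>A\<close>, \<open>B\<close>, \<open>C\<close>, hence \<open>f ^ 4\<close> and \<open>g ^ 4\<close>.\<close>
  have "1 = (u * f + v * g) ^ 8" by (simp add: uv)
  also have "\<dots> = ((u * f + v * g)\<^sup>2)\<^sup>2 ^ 2"
    by (simp flip: power_mult)
  also have "\<dots> = u ^ 8 * f ^ 4 * f ^ 4 + v ^ 8 * g ^ 4 * g ^ 4"
    unfolding sq by (simp add: power_mult_distrib flip: power_mult power_add mult.assoc) (simp add: mult.assoc flip: power_add)
  also have "\<exists>U V. \<dots> = U * f'' + V * g''"
  proof -
    have 1: "f ^ 4 = (g' * f\<^sup>2 + B * f') * g'' + (B * g') * f''"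
    proof -
      have "f ^ 4 = g' * g'' * f\<^sup>2 + B * (f' * g'' + f'' * g')"
        unfolding f4 A by (subst (1) B[symmetric]) (simp add: power2_eq_square)
      then show ?thesis by (simp add: algebra_simps)
    qed
    have 2: "g ^ 4 = (b' * (f' * g\<^sup>2 + B * g')) * f'' + (b' * B * f') * g''"
    proof -
      have "g ^ 4 = b' * (f' * f'' * g\<^sup>2 + B * (f' * g'' + f'' * g'))"
        unfolding g4 C by (subst (1) B[symmetric]) (simp add: power2_eq_square)
      then show ?thesis by (simp add: algebra_simps)
    qed
    have "P * (p1 * g'' + p2 * f'') + Q * (q1 * f'' + q2 * g'') =
       (P * p2 + Q * q1) * f'' + (P * p1 + Q * q2) * g''" for P Q p1 p2 q1 q2 :: "'a poly"
      by (simp add: algebra_simps)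
    then show ?thesis using 1 2 by metis
  qed
  finally have cm'': "comaximal f'' g''" unfolding comaximal_def by metis
  have root: "biq b f g f'' g'' = 0"
  proof -
    have "biq b f g f'' g'' = 2 * (g' * g'' * f''\<^sup>2 + f' * f'' * g''\<^sup>2)"
      unfolding form A B C by (simp add: algebra_simps power2_eq_square)
    then show ?thesis using two by simp
  qed
  define h where "h = height f g"
  have deg: "degree f \<le> h" "degree g \<le> h" by (auto simp: h_def height_def)
  have degx: "degree x = 1" by (simp add: x_def)
  have m: "degree (p * q) \<le> i + j" if "degree p \<le> i" "degree q \<le> j" for p q :: "'a poly" and i j
    using degree_mult_le[of p q] that by linarith
  have degA: "degree A \<le> 2 * h + 2"
  proof -
    have "degree (f + x * g) \<le> h + 1"
      using m[of x 1 g h] degx deg by (intro degree_add_le) auto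
    from m[OF this this] show ?thesis by (simp add: A_def power2_eq_square)
  qed
  have degB: "degree B \<le> 2 * h + 2"
    using m[OF m[of x 1 f h] deg(2)] degx deg by (simp add: B_def)
  have degC: "degree C \<le> 2 * h + 2"
  proof -
    have "degree (x * f) \<le> h + 1" using m[of x 1 f h] degx deg by auto
    then have 1: "degree (x\<^sup>2 * f\<^sup>2) \<le> 2 * h + 2"
      using m[of "x * f" "h + 1" "x * f" "h + 1"] by (simp add: power2_eq_square mult_ac)
    have "degree ([:b:] * g\<^sup>2) \<le> 2 * h + 2"
      using m[OF m[of "[:b:]" 0 g h] deg(2)] deg by (simp add: power2_eq_square)
    with 1 show ?thesis unfolding C_def by (rule degree_add_le)
  qed
  have nz: "p \<noteq> 0 \<or> q \<noteq> 0" if "comaximal p q" for p q :: "'a poly"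
    using that by (auto simp: comaximal_def)
  have "height f' g' + height f'' g'' \<le> 2 * h + 2"
    using degA degB degC unfolding A B C
    by (intro height_add_le_of_product nz cm(2) cm'') auto
  then show ?thesis using that cm'' root by (simp add: h_def)
qed

text \<open>By \<open>biq_step\<close> the heights along the walk have second differences at most 2.
  Summing twice bounds the \<open>n\<close>-th height by the quadratic on the right, and a height is
  never negative.\<close>

lemma biq_chain:
  fixes f0 g0 f1 g1 :: "'a::field poly" and n :: nat
  assumes char: "CHAR('a) = 2" and b: "b \<noteq> 0"
    and cm: "comaximal f0 g0" "comaximal f1 g1" and biq: "biq b f0 g0 f1 g1 = 0"
  shows "0 \<le> int (height f0 g0)
     + int n * (int (height f1 g1) - int (height f0 g0) - 1) + (int n)\<^sup>2"
proof -
  define h where "h = int (height f0 g0)"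
  define \<delta> where "\<delta> = int (height f1 g1) - h"
  \<comment> \<open>The induction carries two consecutive points, with a bound for the current
    increment and one for the current height.\<close>
  have "\<exists>f g f' g'. comaximal f g \<and> comaximal f' g' \<and> biq b f g f' g' = 0
      \<and> int (height f' g') - int (height f g) \<le> 2 * int n + \<delta>
      \<and> int (height f g) \<le> h + int n * (\<delta> - 1) + (int n)\<^sup>2"
  proof (induction n)
    case 0
    show ?case using cm biq
      by (intro exI[of _ f0] exI[of _ g0] exI[of _ f1] exI[of _ g1]) (simp add: h_def \<delta>_def)
  next
    case (Suc n)
    then obtain f g f' g' where *: "comaximal f g" "comaximal f' g'" "biq b f g f' g' = 0"
      "int (height f' g') - int (height f g) \<le> 2 * int n + \<delta>"
      "int (height f g) \<le> h + int n * (\<delta> - 1) + (int n)\<^sup>2" by blast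
    obtain f'' g'' where **: "comaximal f'' g''" "biq b f' g' f'' g'' = 0"
      "height f g + height f'' g'' \<le> 2 * height f' g' + 2"
      using biq_step[OF char b *(2,1)] *(3) biq_sym by metis
    have "int (height f'' g'') - int (height f' g') \<le> 2 * int (Suc n) + \<delta>"
      using **(3) *(4) by simp
    moreover have "int (height f' g') \<le> h + int (Suc n) * (\<delta> - 1) + (int (Suc n))\<^sup>2"
      using *(4,5) by (simp add: algebra_simps power2_eq_square)
    ultimately show ?case using * ** by blast
  qed
  then obtain f g :: "'a poly" where "int (height f g) \<le> h + int n * (\<delta> - 1) + (int n)\<^sup>2"
    by blast
  then show ?thesis unfolding \<delta>_def h_def by linarith
qed

section \<open>Squaring in characteristic 2, trace sums and linear factors\<close>

lemma sum_telescope_CHAR_2: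
  fixes F :: "nat \<Rightarrow> 'a::comm_ring_1"
  assumes "CHAR('a) = 2"
  shows "(\<Sum>i<n. F (Suc i)) + (\<Sum>i<n. F i) = F n + F 0"
proof -
  have "(\<Sum>i<n. F (Suc i)) + (\<Sum>i<n. F i) = (\<Sum>i<n. F (Suc i) - F i)"
    by (simp add: sum.distrib minus_CHAR_2[OF assms])
  also have "\<dots> = F n + F 0"
    using sum_lessThan_telescope[of F n] by (simp add: minus_CHAR_2[OF assms])
  finally show ?thesis .
qed

lemma power2_add_CHAR_2:
  "CHAR('a::comm_ring_1) = 2 \<Longrightarrow> ((x::'a) + y)\<^sup>2 = x\<^sup>2 + y\<^sup>2"
  by (simp add: power2_sum two_eq_0_CHAR_2)

lemma power2_sum_CHAR_2:
  fixes f :: "'b \<Rightarrow> 'a::comm_ring_1"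
  assumes "CHAR('a) = 2"
  shows "(\<Sum>i\<in>A. f i)\<^sup>2 = (\<Sum>i\<in>A. (f i)\<^sup>2)"
  using assms by (intro freshmans_dream_sum) simp_all

lemma power_2_power_add_CHAR_2:
  assumes "CHAR('a::comm_ring_1) = 2"
  shows "((x::'a) + y) ^ 2 ^ i = x ^ 2 ^ i + y ^ 2 ^ i"
proof (induction i)
  case (Suc i)
  have sq: "z ^ 2 ^ Suc i = (z ^ 2 ^ i)\<^sup>2" for z :: 'a
    by (metis power_Suc2 power_mult)
  show ?case unfolding sq Suc.IH power2_add_CHAR_2[OF assms] ..
qed simp

text \<open>On the field with \<open>2 ^ s\<close> elements this is the absolute trace, with values
  kept in the ambient ring. It is defined on the whole ring, so additivity needs no membership in a
  subfield.\<close>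

definition tr :: "nat \<Rightarrow> 'a::comm_ring_1 \<Rightarrow> 'a" where
  "tr s x = (\<Sum>i<s. x ^ (2 ^ i))"

lemma prod_linear_factors_dvd:
  fixes p :: "'a::field poly"
  assumes "finite A" "\<And>a. a \<in> A \<Longrightarrow> poly p a = 0"
  shows "(\<Prod>a\<in>A. [:-a, 1:]) dvd p"
  using assms
proof (induction A arbitrary: p rule: finite_induct)
  case (insert a A)
  then obtain r where r: "p = [:-a, 1:] * r" using poly_eq_0_iff_dvd by (metis dvdE insertI1)
  have "poly r b = 0" if "b \<in> A" for b
    using insert.prems[of b] insert.hyps(2) that unfolding r by auto
  then have "(\<Prod>a\<in>A. [:-a, 1:]) dvd r" by (rule insert.IH)
  then show ?case unfolding r prod.insert[OF insert.hyps(1,2)] by (rule mult_dvd_mono[OF dvd_refl])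
qed auto

lemma degree_prod_linear_factors:
  fixes A :: "'a::field set"
  shows "degree (\<Prod>a\<in>A. [:-a, 1:]) = card A"
  by (cases "finite A") (simp_all add: degree_prod_eq_sum_degree)

section \<open>A lower bound for a Kloosterman count\<close>

text \<open>The abscissa of \<open>Q + P\<close> is \<open>p\<^sup>2 / (x (x ^ (q - 1) + 1)\<^sup>2)\<close>, where \<open>p\<close> is this polynomial with
  \<open>q = 2 ^ Suc s\<close>.\<close>

definition kl_poly :: "nat \<Rightarrow> 'a::field \<Rightarrow> 'a poly" where
  "kl_poly s c = monom 1 (2 ^ Suc s) + (\<Sum>i<s. monom 1 (2 ^ s + 2 ^ i))
     + (\<Sum>i<Suc s. monom (c ^ 2 ^ i) (2 ^ s - 2 ^ i))"

text \<open>Formally the polynomial is \<open>x ^ 2 ^ s * T\<close> with \<open>T\<close> the trace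
  sum of \<open>x + c / x\<close>. Then \<open>T^2 + T\<close> telescopes to
  \<open>x ^ q + c / x ^ q + x + c / x\<close>, and multiplying by \<open>x ^ q\<close> clears the
  denominators and factors.\<close>

lemma kl_poly_quadratic:
  fixes c :: "'a::field"
  assumes char: "CHAR('a) = 2" and c: "c ^ (2 ^ Suc s) = c"
  defines "q \<equiv> 2 ^ Suc s :: nat"
  shows "(kl_poly s c)\<^sup>2 + monom 1 (2 ^ s) * kl_poly s c
     = (monom 1 (q - 1) + 1) * (monom 1 (q + 1) + [:c:])"
proof -
  have char': "CHAR('a poly) = 2" using char by simp
  have two: "p + p = 0" for p :: "'a poly"
    using two_eq_0_CHAR_2[OF char'] by (simp flip: mult_2)
  define F where "F i = monom (1::'a) (q + 2 ^ i)" for i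
  define G where "G i = monom (c ^ 2 ^ i) (q - 2 ^ i)" for i
  have q: "q = 2 ^ s + 2 ^ s" "q \<ge> 1" by (simp_all add: q_def)
  have qq: "q - 2 * 2 ^ s = 0" by (simp add: q_def)
  have Fs': "F s = monom 1 (q + 2 ^ s)" by (simp only: F_def)
  have le: "(2::nat) ^ i \<le> 2 ^ s" if "i < Suc s" for i
    using that by (intro power_increasing) auto
  have sq: "(monom a i)\<^sup>2 = monom (a\<^sup>2) (2 * i)" for a :: 'a and i
    by (simp add: power2_eq_square mult_monom mult_2)
  have Fs: "(monom (1::'a) (2 ^ s + 2 ^ i))\<^sup>2 = F (Suc i)"
    "monom 1 (2 ^ s) * monom (1::'a) (2 ^ s + 2 ^ i) = F i" for i
    by (simp_all add: sq mult_monom F_def q add.assoc)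
  have Gs: "(monom (c ^ 2 ^ i) (2 ^ s - 2 ^ i))\<^sup>2 = G (Suc i)"
    "monom 1 (2 ^ s) * monom (c ^ 2 ^ i) (2 ^ s - 2 ^ i) = G i" if "i < Suc s" for i
  proof -
    have "(c ^ 2 ^ i)\<^sup>2 = c ^ 2 ^ Suc i" by (simp only: power_Suc2 power_mult)
    moreover have "2 * (2 ^ s - 2 ^ i) = q - 2 ^ Suc i" by (simp add: q_def diff_mult_distrib2)
    ultimately show "(monom (c ^ 2 ^ i) (2 ^ s - 2 ^ i))\<^sup>2 = G (Suc i)"
      by (simp only: sq G_def)
    have "2 ^ s + (2 ^ s - 2 ^ i) = q - 2 ^ i" using le[OF that] by (simp add: q(1))
    then show "monom 1 (2 ^ s) * monom (c ^ 2 ^ i) (2 ^ s - 2 ^ i) = G i"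
      by (simp only: mult_monom mult_1_left G_def)
  qed
  have sumG: "(\<Sum>i<Suc s. (monom (c ^ 2 ^ i) (2 ^ s - 2 ^ i))\<^sup>2) = (\<Sum>i<Suc s. G (Suc i))"
    "(\<Sum>i<Suc s. monom 1 (2 ^ s) * monom (c ^ 2 ^ i) (2 ^ s - 2 ^ i)) = (\<Sum>i<Suc s. G i)"
    by (rule sum.cong[OF refl], rule Gs, simp)+
  have "(monom (1::'a) (2 ^ Suc s))\<^sup>2 = monom 1 (2 * q)" by (simp add: sq q_def)
  then have "(kl_poly s c)\<^sup>2 = monom 1 (2 * q) + (\<Sum>i<s. F (Suc i)) + (\<Sum>i<Suc s. G (Suc i))"
    unfolding kl_poly_def power2_add_CHAR_2[OF char'] power2_sum_CHAR_2[OF char'] Fs sumG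
    by (simp only:)
  moreover have "monom (1::'a) (2 ^ s) * monom 1 (2 ^ Suc s) = monom 1 (q + 2 ^ s)"
    by (simp add: mult_monom q_def)
  then have "monom 1 (2 ^ s) * kl_poly s c
      = monom 1 (q + 2 ^ s) + (\<Sum>i<s. F i) + (\<Sum>i<Suc s. G i)"
    unfolding kl_poly_def distrib_left sum_distrib_left Fs sumG by (simp only:)
  ultimately have "(kl_poly s c)\<^sup>2 + monom 1 (2 ^ s) * kl_poly s c
     = monom 1 (2 * q) + monom 1 (q + 2 ^ s) + ((\<Sum>i<s. F (Suc i)) + (\<Sum>i<s. F i))
       + ((\<Sum>i<Suc s. G (Suc i)) + (\<Sum>i<Suc s. G i))"
    by (simp only: add_ac)
  \<comment> \<open>Each sum of squares is the other sum shifted by one, so only the end terms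
    remain. The second \<open>F s\<close> comes from the leading monomial and cancels the
    first.\<close>
  also have "\<dots> = monom 1 (2 * q) + (F s + F s) + F 0 + G (Suc s) + G 0"
    unfolding sum_telescope_CHAR_2[OF char', of F s] sum_telescope_CHAR_2[OF char', of G "Suc s"]
    by (simp only: Fs' add_ac)
  also have "\<dots> = (monom 1 (q - 1) + 1) * (monom 1 (q + 1) + [:c:])"
  proof -
    have a: "monom (1::'a) (q - 1) * monom 1 (q + 1) = monom 1 (2 * q)"
      using q(2) by (simp add: mult_monom mult_2)
    have b: "monom 1 (q - 1) * [:c:] = G 0"
      by (simp add: G_def smult_monom mult.commute[of _ "[:c:]"])
    \<comment> \<open>The exponent \<open>q - 2 ^ Suc s\<close> is 0, and the coefficient is
      \<open>c ^ q = c\<close>.\<close>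
    have d: "[:c:] = G (Suc s)" using c qq by (simp add: G_def monom_0)
    have "(monom 1 (q - 1) + 1) * (monom 1 (q + 1) + [:c:])
      = monom 1 (2 * q) + F 0 + G (Suc s) + G 0"
      unfolding distrib_left distrib_right mult_1_left a b unfolding d
      by (simp only: F_def power_0 add_ac)
    then show ?thesis by (simp only: two add_0_right)
  qed
  finally show ?thesis .
qed

text \<open>Turns trace conditions into roots: a nonzero \<open>a\<close> is a root exactly when the
  trace sum of \<open>a + c / a\<close> vanishes. Those roots will be cancelled from the abscissa of
  \<open>Q + P\<close>.\<close>

lemma poly_kl_poly:
  fixes c a :: "'a::field"
  assumes char: "CHAR('a) = 2" and a: "a \<noteq> 0"
  shows "poly (kl_poly s c) a = a ^ 2 ^ s * tr (Suc s) (a + c / a)"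
proof -
  have pw: "(a + c / a) ^ 2 ^ i = a ^ 2 ^ i + c ^ 2 ^ i / a ^ 2 ^ i" for i
    by (simp only: power_2_power_add_CHAR_2[OF char] power_divide)
  have 1: "tr (Suc s) (a + c / a)
      = (\<Sum>i<s. a ^ 2 ^ i) + a ^ 2 ^ s + (\<Sum>i<Suc s. c ^ 2 ^ i / a ^ 2 ^ i)"
    unfolding tr_def pw sum.distrib by simp
  have 2: "a ^ 2 ^ Suc s = a ^ 2 ^ s * a ^ 2 ^ s" by (simp add: mult_2 power_add)
  have 3: "(\<Sum>i<Suc s. c ^ 2 ^ i * a ^ (2 ^ s - 2 ^ i))
      = a ^ 2 ^ s * (\<Sum>i<Suc s. c ^ 2 ^ i / a ^ 2 ^ i)"
    unfolding sum_distrib_left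
  proof (intro sum.cong refl)
    fix i assume "i \<in> {..<Suc s}"
    then have "(2::nat) ^ i \<le> 2 ^ s" by (intro power_increasing) auto
    then show "c ^ 2 ^ i * a ^ (2 ^ s - 2 ^ i) = a ^ 2 ^ s * (c ^ 2 ^ i / a ^ 2 ^ i)"
      using a by (simp add: power_diff)
  qed
  have 4: "(\<Sum>i<s. a ^ (2 ^ s + 2 ^ i)) = a ^ 2 ^ s * (\<Sum>i<s. a ^ 2 ^ i)"
    by (simp add: sum_distrib_left power_add)
  have "poly (kl_poly s c) a = a ^ 2 ^ Suc s + (\<Sum>i<s. a ^ (2 ^ s + 2 ^ i))
      + (\<Sum>i<Suc s. c ^ 2 ^ i * a ^ (2 ^ s - 2 ^ i))"
    unfolding kl_poly_def poly_add poly_sum poly_monom mult_1_left ..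
  also have "\<dots> = a ^ 2 ^ s * tr (Suc s) (a + c / a)"
    unfolding 1 2 3 4 distrib_left by (simp only: add_ac)
  finally show ?thesis .
qed

lemma degree_kl_poly: "degree (kl_poly s c) = 2 ^ Suc s"
proof -
  have 1: "degree ((\<Sum>i<s. monom (1::'a) (2 ^ s + 2 ^ i))
     + (\<Sum>i<Suc s. monom (c ^ 2 ^ i) (2 ^ s - 2 ^ i))) < 2 ^ Suc s"
  proof (intro degree_add_less degree_sum_less)
    fix i assume "i \<in> {..<s}"
    then have "(2::nat) ^ i < 2 ^ s" by (intro power_strict_increasing) auto
    then show "degree (monom (1::'a) (2 ^ s + 2 ^ i)) < 2 ^ Suc s"
      by (simp add: degree_monom_eq)
  next
    fix i
    have "degree (monom (c ^ 2 ^ i) (2 ^ s - 2 ^ i)) \<le> 2 ^ s"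
      by (rule le_trans[OF degree_monom_le]) simp
    then show "degree (monom (c ^ 2 ^ i) (2 ^ s - 2 ^ i)) < 2 ^ Suc s"
      by (rule le_less_trans) simp
  qed auto
  then show ?thesis
    unfolding kl_poly_def add.assoc
    by (subst degree_add_eq_left) (simp_all add: degree_monom_eq)
qed

text \<open>The walk starts at the Frobenius image, with abscissa \<open>x ^ q\<close> for
  \<open>q = 2 * k\<close>, and its neighbour \<open>p^2 / (x e^2)\<close>. Squaring the quadratic
  relation for \<open>p\<close> and using \<open>x ^ (2 * q) + x^2 = (x e)^2\<close> makes the terms
  cancel in pairs.\<close>

lemma biq_start:
  fixes p e :: "'a::field poly"
  assumes char: "CHAR('a) = 2"
    and quad: "p\<^sup>2 + monom 1 k * p = e * (monom 1 (2 * k + 1) + [:c:])"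
    and e: "e = monom 1 (2 * k - 1) + 1" and k: "k \<ge> 1"
  shows "biq (c\<^sup>2) (monom 1 (2 * k)) 1 (p\<^sup>2) ([:0, 1:] * e\<^sup>2) = 0"
proof -
  have char': "CHAR('a poly) = 2" using char by simp
  define x w where "x = [:0, 1::'a:]" and "w = monom (1::'a) (2 * k)"
  note sq = power2_add_CHAR_2[OF char'] power_mult_distrib
  have w: "w = (monom 1 k)\<^sup>2"
    by (simp add: w_def power2_eq_square mult_monom mult_2)
  have xe: "x * e = w + x"
  proof -
    have "Suc (2 * k - 1) = 2 * k" using k by simp
    moreover have "x * monom 1 n = monom 1 (Suc n)" for n
      by (simp add: x_def monom_Suc)
    ultimately have "x * monom 1 (2 * k - 1) = w" unfolding w_def by metis
    then show ?thesis by (simp add: e distrib_left)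
  qed
  have xw: "monom 1 (2 * k + 1) = x * w"
    by (simp add: x_def w_def monom_Suc)
  have "(p\<^sup>2 + monom 1 k * p)\<^sup>2 = (e * (x * w + [:c:]))\<^sup>2"
    using quad xw by simp
  then have quad2: "(p\<^sup>2)\<^sup>2 + w * p\<^sup>2 = e\<^sup>2 * ((x * w)\<^sup>2 + [:c\<^sup>2:])"
    unfolding sq w[symmetric] by (simp add: power2_eq_square)
  have "biq (c\<^sup>2) w 1 (p\<^sup>2) (x * e\<^sup>2)
     = (w\<^sup>2 + x\<^sup>2) * (p\<^sup>2)\<^sup>2 + (x * e)\<^sup>2 * (w * p\<^sup>2 + e\<^sup>2 * ((x * w)\<^sup>2 + [:c\<^sup>2:]))"
    unfolding biq_def x_def[symmetric] by (simp add: algebra_simps power2_eq_square)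
  also have "w\<^sup>2 + x\<^sup>2 = (x * e)\<^sup>2" unfolding xe sq ..
  also have "(x * e)\<^sup>2 * (p\<^sup>2)\<^sup>2 + (x * e)\<^sup>2 * (w * p\<^sup>2 + e\<^sup>2 * ((x * w)\<^sup>2 + [:c\<^sup>2:]))
     = 2 * ((x * e)\<^sup>2 * (e\<^sup>2 * ((x * w)\<^sup>2 + [:c\<^sup>2:])))"
    unfolding quad2[symmetric] by (simp add: algebra_simps)
  finally show ?thesis using two_eq_0_CHAR_2[OF char'] by (simp add: x_def w_def)
qed

text \<open>The starting height is \<open>q\<close>. After cancellation at the elements of trace 0,
  the height of the neighbour is at most 2 plus twice the number of elements of trace different from
  0. The inequality of \<open>biq_chain\<close> then bounds this number from below.\<close>

lemma kloosterman_count_lower_bound: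
  fixes c :: "'a::field"
  assumes char: "CHAR('a) = 2" and m: "m \<ge> 1"
  defines "q \<equiv> 2 ^ (2 * m) :: nat"
  assumes K: "finite {x::'a. x ^ q = x}" "card {x::'a. x ^ q = x} = q"
    and c: "c ^ q = c" "c \<noteq> 0"
  shows "q + 1 \<le> 2 * 2 ^ m + 2 + 2 * card {a. a ^ q = a \<and> a \<noteq> 0 \<and> tr (2 * m) (a + c / a) \<noteq> 0}"
proof -
  obtain s where s: "2 * m = Suc s" using m by (cases "2 * m") auto
  define k :: nat where "k = 2 ^ s"
  have q: "q = 2 * k" "k \<ge> 1" "q = 2 ^ Suc s" "q \<ge> 2" by (simp_all add: q_def s k_def)
  define p where "p = kl_poly s c"
  define e where "e = monom (1::'a) (q - 1) + 1"
  define K where "K = {a::'a. a ^ q = a \<and> a \<noteq> 0}"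
  define A0 where "A0 = {a \<in> K. tr (2 * m) (a + c / a) = 0}"
  define A1 where "A1 = {a \<in> K. tr (2 * m) (a + c / a) \<noteq> 0}"
  have finK: "finite K" using K(1) unfolding K_def by (rule finite_subset[rotated]) auto
  have "{x::'a. x ^ q = x} = insert 0 K" using q(4) by (auto simp: K_def)
  then have cardK: "card K = q - 1" using K(2) finK by (simp add: K_def)
  have fin: "finite A0" "finite A1" using finK by (auto simp: A0_def A1_def)
  have "K = A0 \<union> A1" "A0 \<inter> A1 = {}" by (auto simp: A0_def A1_def)
  then have card01: "card A0 + card A1 = q - 1"
    using card_Un_disjoint[OF fin] cardK by simp
  \<comment> \<open>All nonzero elements of the subfield are roots of \<open>e\<close>, and those of
    trace 0 are also roots of \<open>p\<close>, so \<open>P0\<close> is a common factor.\<close>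
  define P0 where "P0 = (\<Prod>a\<in>A0. [:-a, 1:])"
  have P0: "P0 \<noteq> 0" using fin by (simp add: P0_def)
  have degP0: "degree P0 = card A0" by (simp add: P0_def degree_prod_linear_factors)
  have "P0 dvd p" unfolding P0_def p_def
    by (intro prod_linear_factors_dvd fin) (auto simp: A0_def K_def poly_kl_poly[OF char] s q(3))
  then obtain p' where p': "p = P0 * p'" by auto
  have "P0 dvd e" unfolding P0_def
  proof (intro prod_linear_factors_dvd fin)
    fix a assume "a \<in> A0"
    then have a: "a ^ q = a" "a \<noteq> 0" by (auto simp: A0_def K_def)
    have "a * a ^ (q - 1) = a" using a(1) q(4) by (simp flip: power_Suc)
    then have "a ^ (q - 1) = 1" using a(2) by simp
    then show "poly e a = 0"
      using two_eq_0_CHAR_2[OF char] by (simp add: e_def poly_monom)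
  qed
  then obtain e' where e': "e = P0 * e'" by auto
  have degp: "degree p = q" unfolding p_def q(3) by (rule degree_kl_poly)
  have dege: "degree e = q - 1"
    using q(4) unfolding e_def by (subst degree_add_eq_left) (simp_all add: degree_monom_eq)
  have nz: "p' \<noteq> 0" "e' \<noteq> 0" using degp dege q(4) p' e' by auto
  have degp': "degree p' = 1 + card A1"
    using degp card01 P0 nz q(4) unfolding p' by (simp add: degree_mult_eq degP0)
  have dege': "degree e' = card A1"
    using dege card01 P0 nz q(4) unfolding e' by (simp add: degree_mult_eq degP0)
  have "biq (c\<^sup>2) (monom 1 q) 1 (p\<^sup>2) ([:0, 1:] * e\<^sup>2) = 0"
  proof -
    have "p\<^sup>2 + monom 1 k * p = e * (monom 1 (2 * k + 1) + [:c:])"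
      using kl_poly_quadratic[OF char c(1)[unfolded q(3)]]
      unfolding p_def e_def k_def q(3) power_Suc .
    moreover have "e = monom 1 (2 * k - 1) + 1" by (simp only: e_def q(1))
    ultimately show ?thesis unfolding q(1) using biq_start[OF char _ _ q(2)] by blast
  qed
  then have "(P0\<^sup>2)\<^sup>2 * biq (c\<^sup>2) (monom 1 q) 1 (p'\<^sup>2) ([:0, 1:] * e'\<^sup>2) = 0"
    unfolding biq_scale[symmetric] p' e' power_mult_distrib mult.left_commute[of _ "P0\<^sup>2"] .
  then have biq': "biq (c\<^sup>2) (monom 1 q) 1 (p'\<^sup>2) ([:0, 1:] * e'\<^sup>2) = 0"
    using P0 by (subst (asm) mult_eq_0_iff) simp
  \<comment> \<open>Common factors may remain; removing them only lowers the degrees.\<close>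
  obtain d u v f g where d: "d \<noteq> 0" and f: "p'\<^sup>2 = d * f" and g: "[:0, 1:] * e'\<^sup>2 = d * g"
    and uv: "u * f + v * g = 1"
    using poly_bezout[of "p'\<^sup>2" "[:0, 1:] * e'\<^sup>2"] nz by (metis power_not_zero)
  have biq: "biq (c\<^sup>2) (monom 1 q) 1 f g = 0"
    using biq' d unfolding f g biq_scale by (subst (asm) mult_eq_0_iff) simp
  have fg: "f \<noteq> 0" "g \<noteq> 0" using f g nz by auto
  have "degree (d * f) = 2 + 2 * card A1"
    unfolding f[symmetric] using nz by (simp add: degree_power_eq degp')
  then have "degree f \<le> 2 + 2 * card A1" using d fg by (simp add: degree_mult_eq)
  moreover have "degree (d * g) = 1 + 2 * card A1"
    unfolding g[symmetric] using nz by (simp add: degree_mult_eq degree_power_eq dege' del: mult_pCons_left)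
  then have "degree g \<le> 1 + 2 * card A1" using d fg by (simp add: degree_mult_eq)
  ultimately have h1: "height f g \<le> 2 + 2 * card A1" by (simp add: height_def)
  have h0: "height (monom (1::'a) q) 1 = q" by (simp add: height_def degree_monom_eq)
  have cm: "comaximal (monom (1::'a) q) 1" "comaximal f g"
    using uv unfolding comaximal_def by (auto intro: exI[of _ 0] exI[of _ 1])
  define r :: int where "r = 2 ^ m"
  have qr: "int q = r\<^sup>2" by (simp add: q_def r_def mult.commute[of 2 m] power_mult)
  have "c\<^sup>2 \<noteq> 0" using c by simp
  \<comment> \<open>The number of steps is the square root \<open>r\<close> of \<open>q\<close>;
    then the quadratic bound is divisible by \<open>r\<close>.\<close>
  from biq_chain[OF char this cm biq, of "2 ^ m"]
  have "0 \<le> int q + r * (int (height f g) - int q - 1) + r\<^sup>2"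
    unfolding h0 by (simp add: r_def)
  also have "\<dots> = r * (int (height f g) - int q - 1 + 2 * r)"
    unfolding qr by (simp add: algebra_simps power2_eq_square)
  finally have "0 \<le> r * (int (height f g) - int q - 1 + 2 * r)" .
  moreover have "0 < r" by (simp add: r_def)
  ultimately have "0 \<le> int (height f g) - int q - 1 + 2 * r"
    by (simp add: zero_le_mult_iff)
  moreover have "r = int (2 ^ m)" by (simp add: r_def)
  ultimately have "q + 1 \<le> 2 * 2 ^ m + 2 + 2 * card A1"
    using h1 by linarith
  also have "A1 = {a. a ^ q = a \<and> a \<noteq> 0 \<and> tr (2 * m) (a + c / a) \<noteq> 0}"
    by (auto simp: A1_def K_def)
  finally show ?thesis .
qed

section \<open>Traces\<close>

lemma tr_add:
  "CHAR('a::comm_ring_1) = 2 \<Longrightarrow> tr s ((x::'a) + y) = tr s x + tr s y"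
  by (simp add: tr_def power_2_power_add_CHAR_2 sum.distrib)

lemma tr_0 [simp]: "tr s 0 = 0"
  by (simp add: tr_def power_0_left)

lemma tr_sum:
  "CHAR('a::comm_ring_1) = 2 \<Longrightarrow> tr s (\<Sum>i\<in>A. f i :: 'a) = (\<Sum>i\<in>A. tr s (f i))"
  by (induction A rule: infinite_finite_induct) (simp_all add: tr_add)

text \<open>Squaring shifts the summands by one place, so the sum telescopes.\<close>

lemma tr_power2_add:
  assumes "CHAR('a::comm_ring_1) = 2"
  shows "(tr s (x::'a))\<^sup>2 + tr s x = x ^ 2 ^ s + x"
proof -
  have sq: "(z ^ 2 ^ i)\<^sup>2 = z ^ 2 ^ Suc i" for z :: 'a and i
    by (metis power_Suc2 power_mult)
  have "(tr s x)\<^sup>2 = (\<Sum>i<s. x ^ 2 ^ Suc i)"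
    unfolding tr_def power2_sum_CHAR_2[OF assms] sq ..
  then show ?thesis
    using sum_telescope_CHAR_2[OF assms, of "\<lambda>i. x ^ 2 ^ i" s] by (simp add: tr_def)
qed

lemma tr_in_prime_field:
  assumes "CHAR('a::idom) = 2" "(x::'a) ^ 2 ^ s = x"
  shows "tr s x = 0 \<or> tr s x = 1"
proof -
  have "tr s x * (tr s x + 1) = 0"
    using tr_power2_add[OF assms(1), of s x] two_eq_0_CHAR_2[OF assms(1)] assms(2)
    by (simp add: power2_eq_square distrib_left flip: mult_2)
  then show ?thesis
    by (metis add_eq_0_iff2 mult_eq_0_iff uminus_CHAR_2[OF assms(1)])
qed

text \<open>For \<open>s = t\<close> and together with additivity this is the transitivity of the
  trace.\<close>

lemma tr_add_index: "tr (s + t) x = tr s x + tr t (x ^ 2 ^ s)"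
proof -
  have "tr (s + t) x = (\<Sum>i<s. x ^ 2 ^ i) + (\<Sum>i<t. x ^ 2 ^ (s + i))"
    unfolding tr_def by (induction t) (simp_all add: add.assoc)
  then show ?thesis by (simp add: tr_def power_add power_mult)
qed

text \<open>As a polynomial the trace has degree \<open>2 ^ (s - 1)\<close>, hence fewer than
  \<open>2 ^ s\<close> roots.\<close>

lemma tr_nonzero_exists:
  fixes S :: "'a::idom set"
  assumes "finite S" "card S \<ge> 2 ^ s" "s > 0"
  obtains x where "x \<in> S" "tr s x \<noteq> 0"
proof -
  obtain t where t: "s = Suc t" using assms(3) by (cases s) auto
  define p where "p = (\<Sum>i<s. monom (1::'a) (2 ^ i))"
  have p: "poly p x = tr s x" for x by (simp add: p_def tr_def poly_sum poly_monom)
  have "degree (\<Sum>i<t. monom (1::'a) (2 ^ i)) < 2 ^ t"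
    by (rule degree_sum_less) (simp_all add: degree_monom_eq)
  then have deg: "degree p = 2 ^ t"
    by (simp add: p_def t degree_add_eq_right degree_monom_eq)
  then have "p \<noteq> 0" by auto
  then have "card {x. poly p x = 0} \<le> 2 ^ t" "finite {x. poly p x = 0}"
    using card_poly_roots_bound deg poly_roots_finite by metis+
  moreover have "(2::nat) ^ t < 2 ^ s" by (simp add: t)
  ultimately have "\<not> S \<subseteq> {x. poly p x = 0}"
    using assms(2) card_mono by (metis leD le_trans)
  then show ?thesis using that p by auto
qed

text \<open>Translation by \<open>x0\<close> is an involution of \<open>S\<close> that exchanges the
  two fibres.\<close>

lemma card_kernel_eq_card_complement:
  fixes \<phi> :: "'a::ab_group_add \<Rightarrow> 'b::ab_group_add"
  assumes fin: "finite S" and closed: "\<And>x y. x \<in> S \<Longrightarrow> y \<in> S \<Longrightarrow> x + y \<in> S"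
    and self: "\<And>x. x \<in> S \<Longrightarrow> x + x = 0"
    and add: "\<And>x y. \<phi> (x + y) = \<phi> x + \<phi> y"
    and two: "\<And>x. x \<in> S \<Longrightarrow> \<phi> x = 0 \<or> \<phi> x = e" "e \<noteq> 0" "e + e = 0"
    and ex: "x0 \<in> S" "\<phi> x0 \<noteq> 0"
  shows "card {x \<in> S. \<phi> x \<noteq> 0} = card {x \<in> S. \<phi> x = 0}"
proof (rule bij_betw_same_card[of "\<lambda>x. x + x0"], rule bij_betw_byWitness[of _ "\<lambda>x. x + x0"])
  have e: "\<phi> x = e" if "x \<in> S" "\<phi> x \<noteq> 0" for x using two(1) that by auto
  have e0: "\<phi> x + \<phi> x0 = 0" if "x \<in> S" "\<phi> x \<noteq> 0" for x
    using e[OF that] e[OF ex] two(3) by simp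
  have "x + x0 + x0 = x" for x using self[OF ex(1)] by (simp add: add.assoc)
  then show "\<forall>a\<in>{x \<in> S. \<phi> x \<noteq> 0}. a + x0 + x0 = a" "\<forall>a\<in>{x \<in> S. \<phi> x = 0}. a + x0 + x0 = a"
    by auto
  show "(\<lambda>x. x + x0) ` {x \<in> S. \<phi> x \<noteq> 0} \<subseteq> {x \<in> S. \<phi> x = 0}"
    using e0 ex closed by (auto simp: add)
  show "(\<lambda>x. x + x0) ` {x \<in> S. \<phi> x = 0} \<subseteq> {x \<in> S. \<phi> x \<noteq> 0}"
    using e closed ex by (auto simp: add)
qed

lemma card_Collect_two_to_one:
  assumes "finite A" "\<And>a. a \<in> A \<Longrightarrow> card {a' \<in> A. f a' = f a} = 2"
  shows "card {a \<in> A. P (f a)} = 2 * card {b \<in> f ` A. P b}"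
proof -
  have "{a \<in> A. P (f a)} = (\<Union>b\<in>{b \<in> f ` A. P b}. {a \<in> A. f a = b})" by auto
  also have "card \<dots> = (\<Sum>b\<in>{b \<in> f ` A. P b}. card {a \<in> A. f a = b})"
    using assms(1) by (intro card_UN_disjoint) auto
  also have "\<dots> = (\<Sum>b\<in>{b \<in> f ` A. P b}. 2)"
    using assms(2) by (intro sum.cong) auto
  finally show ?thesis by simp
qed

text \<open>Translation by 1 permutes the field, so comparing the sums of all elements gives that
  the cardinality is 0 in the field.\<close>

lemma CHAR_2_of_card:
  assumes "CARD('a::idom) = 2 ^ k"
  shows "CHAR('a) = 2"
proof -
  have fin: "finite (UNIV :: 'a set)" using assms by (intro card_ge_0_finite) simp
  have "(\<Sum>x\<in>UNIV. x + 1) = (\<Sum>x\<in>UNIV. x :: 'a)"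
    by (rule sum.reindex_bij_witness[of _ "\<lambda>x. x - 1" "\<lambda>x. x + 1"]) auto
  then have "of_nat CARD('a) = (0::'a)" by (simp add: sum.distrib)
  then have "(2::'a) ^ k = 0" using assms by simp
  then have "of_nat 2 = (0::'a)" by simp
  then have "CHAR('a) dvd 2" by (simp only: of_nat_eq_0_iff_char_dvd)
  then show ?thesis by (metis CHAR_not_1' One_nat_def prime_nat_iff two_is_prime_nat)
qed

section \<open>The field with \<open>2 ^ (4 * m)\<close> elements, its subfield \<open>K\<close> and
  the group \<open>U\<close> of norm 1\<close>

locale zetterberg_field =
  fixes m :: nat and \<theta> :: "'a::field"
  assumes m: "m \<ge> 1"
    and card_UNIV: "CARD('a) = 2 ^ (4 * m)"
    and power_card_UNIV: "\<And>x::'a. x ^ 2 ^ (4 * m) = x"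
    and card_fixed: "card {x::'a. x ^ 2 ^ (2 * m) = x} = 2 ^ (2 * m)"
    and \<theta>: "\<theta> ^ (2 ^ (2 * m) + 1) = 1"
    and inj_\<theta>: "inj_on (\<lambda>i. \<theta> ^ i) {..<2 ^ (2 * m) + 1}"
begin

definition q :: nat where "q = 2 ^ (2 * m)"
definition K :: "'a set" where "K = {x. x ^ q = x}"
definition U :: "'a set" where "U = {u. u ^ (q + 1) = 1}"

lemma char: "CHAR('a) = 2"
  by (rule CHAR_2_of_card[OF card_UNIV])

lemma finite_any [simp]: "finite (A :: 'a set)"
proof -
  have "finite (UNIV :: 'a set)" using card_UNIV by (intro card_ge_0_finite) simp
  then show ?thesis by (rule finite_subset[rotated]) simp
qed

lemma add_self [simp]: "x + x = (0::'a)"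
  using two_eq_0_CHAR_2[OF char] by (simp flip: mult_2)

lemma add_eq_0_iff_eq: "x + y = 0 \<longleftrightarrow> x = (y::'a)"
  by (metis add_eq_0_iff2 uminus_CHAR_2[OF char])

lemma q_ge: "q \<ge> 4" "even q"
proof -
  have "(2::nat) ^ 2 \<le> 2 ^ (2 * m)" using m by (intro power_increasing) auto
  then show "q \<ge> 4" by (simp add: q_def)
  show "even q" using m by (simp add: q_def)
qed

lemma q_square: "q * q = 2 ^ (4 * m)"
  by (simp add: q_def flip: power_add)

lemma power_q_add: "(x + y) ^ q = x ^ q + (y::'a) ^ q"
  unfolding q_def by (rule power_2_power_add_CHAR_2[OF char])

lemma power_q_q: "(x ^ q) ^ q = (x::'a)"
  using power_card_UNIV[of x] by (simp add: q_square flip: power_mult)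

lemma K_closed:
  "0 \<in> K" "1 \<in> K" "x \<in> K \<Longrightarrow> y \<in> K \<Longrightarrow> x + y \<in> K" "x \<in> K \<Longrightarrow> y \<in> K \<Longrightarrow> x * y \<in> K"
  "x \<in> K \<Longrightarrow> y \<in> K \<Longrightarrow> x / y \<in> K"
  using q_ge by (auto simp: K_def power_q_add power_mult_distrib power_divide)

lemma card_K: "card K = q"
  using card_fixed by (simp add: K_def q_def)

lemma U_nonzero: "u \<in> U \<Longrightarrow> u \<noteq> 0"
  by (auto simp: U_def)

lemma U_closed: "1 \<in> U" "u \<in> U \<Longrightarrow> v \<in> U \<Longrightarrow> u * v \<in> U" "u \<in> U \<Longrightarrow> v \<in> U \<Longrightarrow> u / v \<in> U"
  unfolding U_def by (simp_all only: mem_Collect_eq power_one power_mult_distrib power_divide mult_1_left div_by_1)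

lemma U_power_q: "u \<in> U \<Longrightarrow> u ^ q = 1 / u"
  using U_nonzero[of u] by (simp add: U_def field_simps)

text \<open>The \<open>q + 1\<close> distinct powers of \<open>\<theta>\<close> already exhaust the
  possible roots of \<open>x ^ (q + 1) - 1\<close>.\<close>

lemma U_eq: "U = (\<lambda>i. \<theta> ^ i) ` {..<q + 1}" and card_U: "card U = q + 1"
proof -
  define p where "p = monom 1 (q + 1) + [:-1::'a:]"
  have deg: "degree p = q + 1"
    unfolding p_def by (subst degree_add_eq_left) (simp_all add: degree_monom_eq)
  then have "p \<noteq> 0" by auto
  have U: "U = {x. poly p x = 0}" by (simp add: U_def p_def poly_monom)
  have le: "card U \<le> q + 1"
    unfolding U using card_poly_roots_bound[OF \<open>p \<noteq> 0\<close>] deg by simp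
  have sub: "(\<lambda>i. \<theta> ^ i) ` {..<q + 1} \<subseteq> U"
  proof
    fix x assume "x \<in> (\<lambda>i. \<theta> ^ i) ` {..<q + 1}"
    then obtain i where "x = \<theta> ^ i" by auto
    then have "x ^ (q + 1) = (\<theta> ^ (q + 1)) ^ i" by (metis mult.commute power_mult)
    also have "\<dots> = 1" using \<theta> by (simp only: q_def power_one)
    finally show "x \<in> U" by (simp add: U_def)
  qed
  have card: "card ((\<lambda>i. \<theta> ^ i) ` {..<q + 1}) = q + 1"
    using card_image[OF inj_\<theta>] by (simp add: q_def)
  show "U = (\<lambda>i. \<theta> ^ i) ` {..<q + 1}"
    using card_seteq[OF _ sub] le card by simp
  then show "card U = q + 1" using card by simp
qed

lemma \<theta>_nonzero: "\<theta> \<noteq> 0"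
  using \<theta> by auto

lemma K_power: "x \<in> K \<Longrightarrow> x ^ 2 ^ (2 * m) = x"
  by (simp add: K_def q_def)

lemma trK_01: "x \<in> K \<Longrightarrow> tr (2 * m) x = 0 \<or> tr (2 * m) x = 1"
  by (rule tr_in_prime_field[OF char K_power])

lemma tr_01: "tr (4 * m) x = 0 \<or> tr (4 * m) (x::'a) = 1"
  by (rule tr_in_prime_field[OF char power_card_UNIV])

lemma tr_eq_trK: "tr (4 * m) x = tr (2 * m) (x + x ^ q :: 'a)"
proof -
  have "tr (4 * m) x = tr (2 * m + 2 * m) x" by simp
  then show ?thesis unfolding tr_add_index tr_add[OF char] q_def .
qed

lemma trK_1: "tr (2 * m) 1 = (0::'a)"
  using two_eq_0_CHAR_2[OF char] by (simp add: tr_def)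

lemma card_trK_nonzero: "2 * card {x \<in> K. tr (2 * m) x \<noteq> 0} = q"
proof -
  obtain x0 where x0: "x0 \<in> K" "tr (2 * m) x0 \<noteq> 0"
    using tr_nonzero_exists[of K "2 * m"] card_K m by (auto simp: q_def)
  have "card {x \<in> K. tr (2 * m) x \<noteq> 0} = card {x \<in> K. tr (2 * m) x = 0}"
    using x0 K_closed trK_01 tr_add[OF char, of "2 * m"]
    by (intro card_kernel_eq_card_complement[where e = 1]) auto
  moreover have "card {x \<in> K. tr (2 * m) x \<noteq> 0} + card {x \<in> K. tr (2 * m) x = 0} = card K"
    by (subst card_Un_disjoint[symmetric]) (auto intro: arg_cong[where f = card])
  ultimately show ?thesis using card_K by simp
qed

lemma card_trK_scaled:
  assumes "c \<in> K" "c \<noteq> 0"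
  shows "2 * card {z \<in> K - {0}. tr (2 * m) (c * z) \<noteq> 0} = q"
proof -
  have "card {z \<in> K - {0}. tr (2 * m) (c * z) \<noteq> 0} = card {x \<in> K. tr (2 * m) x \<noteq> 0}"
    by (rule bij_betw_same_card[of "\<lambda>z. c * z"], rule bij_betw_byWitness[of _ "\<lambda>x. x / c"])
      (use assms K_closed in auto)
  then show ?thesis using card_trK_nonzero by simp
qed

text \<open>By the Artin-Schreier criterion these are the \<open>z\<close> for which
  \<open>X^2 + z X + 1\<close> is irreducible over \<open>K\<close>. They turn out to be the values
  of \<open>u + 1 / u\<close> on \<open>U - {1}\<close>.\<close>

definition Z :: "'a set" where
  "Z = {z \<in> K - {0}. tr (2 * m) (1 / z) \<noteq> 0}"

lemma card_Z: "2 * card Z = q"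
proof -
  have "card Z = card {x \<in> K. tr (2 * m) x \<noteq> 0}"
    unfolding Z_def
    by (rule bij_betw_same_card[of "\<lambda>z. 1 / z"], rule bij_betw_byWitness[of _ "\<lambda>x. 1 / x"])
      (use K_closed in auto)
  then show ?thesis using card_trK_nonzero by simp
qed

text \<open>With \<open>v = 1 / (u + 1)\<close> one has \<open>1 / (u + 1 / u) = v^2 + v\<close>,
  whose trace telescopes to \<open>v ^ q + v\<close>. Since the \<open>q\<close>-th power inverts
  \<open>u\<close>, this is \<open>u / (u + 1) + 1 / (u + 1) = 1\<close>.\<close>

lemma add_inverse_mem_Z:
  assumes "u \<in> U - {1}"
  shows "u + 1 / u \<in> Z"
proof -
  have u: "u \<in> U" "u \<noteq> 1" "u \<noteq> 0" using assms U_nonzero by auto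
  have u1: "u + 1 \<noteq> 0" using u add_eq_0_iff_eq by blast
  have sq: "(u + 1)\<^sup>2 = u\<^sup>2 + 1" using power2_add_CHAR_2[OF char, of u 1] by simp
  have eq: "u + 1 / u = (u + 1)\<^sup>2 / u" using u unfolding sq by (simp add: field_simps power2_eq_square)
  define v where "v = 1 / (u + 1)"
  have "u + 1 / u \<in> K"
    using U_power_q[OF u(1)] by (simp add: K_def power_q_add power_divide)
  moreover have "u + 1 / u \<noteq> 0" unfolding eq using u u1 by simp
  moreover have "tr (2 * m) (1 / (u + 1 / u)) = 1"
  proof -
    have "v\<^sup>2 = 1 / (u + 1)\<^sup>2" "v = (u + 1) / (u + 1)\<^sup>2"
      using u1 by (simp_all add: v_def power_divide power2_eq_square)
    then have "v\<^sup>2 + v = (1 + (u + 1)) / (u + 1)\<^sup>2"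
      by (metis add_divide_distrib)
    also have "1 + (u + 1) = u" by (metis add.commute add.left_commute add_self add_0_right)
    finally have "1 / (u + 1 / u) = v\<^sup>2 + v" unfolding eq by simp
    then have "tr (2 * m) (1 / (u + 1 / u)) = (tr (2 * m) v)\<^sup>2 + tr (2 * m) v"
      by (simp add: tr_add[OF char]) (simp add: tr_def power2_sum_CHAR_2[OF char] mult.commute flip: power_mult)
    also have "\<dots> = v ^ q + v" by (simp add: tr_power2_add[OF char] q_def)
    also have "v ^ q = 1 / (1 / u + 1)"
      using U_power_q[OF u(1)] by (simp add: v_def power_divide power_q_add)
    also have "\<dots> = u / (u + 1)" using u u1 by (simp add: field_simps)
    also have "\<dots> + v = 1" using u1 by (simp add: v_def flip: add_divide_distrib)
    finally show ?thesis .
  qed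
  ultimately show ?thesis by (simp add: Z_def)
qed

text \<open>Equality of the values at \<open>w\<close> and \<open>u\<close> means
  \<open>(w + u) * (w * u + 1) = 0\<close>. The solutions \<open>u\<close> and \<open>1 / u\<close>
  differ because 0 is not in \<open>Z\<close>.\<close>

lemma add_inverse_two_to_one:
  assumes "u \<in> U - {1}"
  shows "card {w \<in> U - {1}. w + 1 / w = u + 1 / u} = 2"
proof -
  have u: "u \<in> U" "u \<noteq> 1" "u \<noteq> 0" using assms U_nonzero by auto
  have "w = u \<or> w = 1 / u" if w: "w + 1 / w = u + 1 / u" "w \<noteq> 0" for w
  proof -
    have "(w + u) * (w * u + 1) = w * u * ((w + 1 / w) + (u + 1 / u))
        + (w * u * u + w * u * u) * 0"
      using w(2) u(3) by (simp add: field_simps)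
    also have "\<dots> = 0" using w(1) by simp
    finally have "w = u \<or> w * u = 1" using add_eq_0_iff_eq by simp
    then show ?thesis using u(3) by (auto simp: field_simps)
  qed
  moreover have "1 / u \<in> U - {1}" using u U_closed(3)[OF U_closed(1)] by auto
  ultimately have "{w \<in> U - {1}. w + 1 / w = u + 1 / u} = {u, 1 / u}"
    using assms U_nonzero by (auto simp: add.commute)
  moreover have "u \<noteq> 1 / u"
  proof
    assume "u = 1 / u"
    then have "u + 1 / u = 0" by (metis add_self)
    then show False using add_inverse_mem_Z[OF assms] by (simp add: Z_def)
  qed
  ultimately show ?thesis by simp
qed

text \<open>The map is two-to-one on \<open>q\<close> elements, and \<open>Z\<close> has
  \<open>q / 2\<close> elements.\<close>

lemma add_inverse_image: "(\<lambda>u. u + 1 / u) ` (U - {1}) = Z"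
proof (rule card_seteq)
  have "card (U - {1}) = 2 * card ((\<lambda>u. u + 1 / u) ` (U - {1}))"
    using card_Collect_two_to_one[OF _ add_inverse_two_to_one, where P = "\<lambda>_. True"]
    by (simp only: simp_thms Collect_mem_eq finite_any)
  moreover have "card (U - {1}) = q" using card_U U_closed(1) by simp
  ultimately show "card Z \<le> card ((\<lambda>u. u + 1 / u) ` (U - {1}))" using card_Z by simp
qed (use add_inverse_mem_Z in auto)

lemma card_U_eq_card_Z:
  "card {u \<in> U - {1}. P (u + 1 / u)} = 2 * card {z \<in> Z. P z}"
  using card_Collect_two_to_one[OF _ add_inverse_two_to_one, of P] add_inverse_image by simp

text \<open>The substitution \<open>a = c * z\<close> turns the Kloosterman condition into: exactly
  one of the traces of \<open>c * z\<close> and \<open>1 / z\<close> is nonzero. Each trace is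
  nonzero for \<open>q / 2\<close> values of \<open>z\<close>, so the two cases are equally
  frequent, and one of them is the set to be counted.\<close>

lemma card_Z_trK_zero:
  assumes c: "c \<in> K" "c \<noteq> 0"
  shows "q \<le> 2 * 2 ^ m + 4 * card {z \<in> Z. tr (2 * m) (c * z) = 0}"
proof -
  let ?T = "\<lambda>z. tr (2 * m) (c * z)" and ?S = "\<lambda>z. tr (2 * m) (1 / z)"
  define B where "B = {z \<in> K - {0}. ?S z \<noteq> 0 \<and> ?T z = 0}"
  define B' where "B' = {z \<in> K - {0}. ?S z = 0 \<and> ?T z \<noteq> 0}"
  define E where "E = {z \<in> K - {0}. ?S z \<noteq> 0 \<and> ?T z \<noteq> 0}"
  have "Z = B \<union> E" "B \<inter> E = {}" by (auto simp: Z_def B_def E_def)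
  then have 1: "card Z = card B + card E" by (simp add: card_Un_disjoint)
  have "{z \<in> K - {0}. ?T z \<noteq> 0} = B' \<union> E" "B' \<inter> E = {}" by (auto simp: B'_def E_def)
  then have 2: "card {z \<in> K - {0}. ?T z \<noteq> 0} = card B' + card E" by (simp add: card_Un_disjoint)
  have BB': "card B = card B'" using 1 2 card_Z card_trK_scaled[OF c] by simp
  have "card {a. a ^ q = a \<and> a \<noteq> 0 \<and> tr (2 * m) (a + c / a) \<noteq> 0} = card (B \<union> B')"
  proof (rule bij_betw_same_card[of "\<lambda>a. a / c"], rule bij_betw_byWitness[of _ "\<lambda>z. c * z"])
    have key: "tr (2 * m) (c * z + 1 / z) \<noteq> 0 \<longleftrightarrow> (?S z \<noteq> 0) \<noteq> (?T z \<noteq> 0)"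
      if "z \<in> K" for z
    proof -
      have "c * z \<in> K" "1 / z \<in> K" using that c K_closed by auto
      from trK_01[OF this(1)] trK_01[OF this(2)] show ?thesis by (auto simp: tr_add[OF char])
    qed
    have A: "{a. a ^ q = a \<and> a \<noteq> 0 \<and> tr (2 * m) (a + c / a) \<noteq> 0}
        = {a \<in> K - {0}. tr (2 * m) (a + c / a) \<noteq> 0}" by (auto simp: K_def)
    show "(\<lambda>a. a / c) ` {a. a ^ q = a \<and> a \<noteq> 0 \<and> tr (2 * m) (a + c / a) \<noteq> 0} \<subseteq> B \<union> B'"
      unfolding A
    proof (rule image_subsetI)
      fix a assume a: "a \<in> {a \<in> K - {0}. tr (2 * m) (a + c / a) \<noteq> 0}"
      then have "a / c \<in> K - {0}" using c K_closed by auto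
      moreover have "c * (a / c) + 1 / (a / c) = a + c / a" using c by simp
      ultimately show "a / c \<in> B \<union> B'" using key[of "a / c"] a by (auto simp: B_def B'_def)
    qed
    show "(\<lambda>z. c * z) ` (B \<union> B') \<subseteq> {a. a ^ q = a \<and> a \<noteq> 0 \<and> tr (2 * m) (a + c / a) \<noteq> 0}"
      unfolding A
    proof (rule image_subsetI)
      fix z assume z: "z \<in> B \<union> B'"
      then have "z \<in> K - {0}" by (auto simp: B_def B'_def)
      moreover have "c * z + c / (c * z) = c * z + 1 / z" using c by simp
      ultimately show "c * z \<in> {a \<in> K - {0}. tr (2 * m) (a + c / a) \<noteq> 0}"
        using key[of z] z c K_closed by (auto simp: B_def B'_def)
    qed
  qed (use c in auto)
  also have "\<dots> = 2 * card B"
    using BB' by (subst card_Un_disjoint) (auto simp: B_def B'_def)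
  finally have "q + 1 \<le> 2 * 2 ^ m + 2 + 4 * card B"
    using kloosterman_count_lower_bound[OF char m, of c] c card_fixed by (simp add: K_def q_def)
  \<comment> \<open>Parity improves the bound by 1: \<open>q\<close> and all other terms apart from
    the 1 on the left are even.\<close>
  moreover obtain k where "q = 2 * k" using q_ge(2) by (elim evenE)
  ultimately have "k \<le> 2 ^ m + 2 * card B" by linarith
  then have "q \<le> 2 * 2 ^ m + 4 * card B" using \<open>q = 2 * k\<close> by linarith
  also have "B = {z \<in> Z. ?T z = 0}" by (auto simp: Z_def B_def)
  finally show ?thesis .
qed

text \<open>Take for \<open>c\<close> the square root in \<open>K\<close> of the norm
  \<open>a ^ (q + 1)\<close>; on \<open>K\<close> the power \<open>q div 2\<close> inverts squaring.
  Since \<open>c\<close> itself has norm \<open>c^2\<close>, the quotient \<open>a / c\<close> has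
  norm 1.\<close>

lemma polar_decomposition:
  assumes "a \<noteq> 0"
  obtains c v where "a = c * v" "c \<in> K" "c \<noteq> 0" "v \<in> U"
proof -
  define c where "c = (a ^ (q + 1)) ^ (q div 2)"
  have N: "(a ^ (q + 1)) ^ q = a ^ (q + 1)"
    using power_q_q[of a] by (simp add: power_mult_distrib mult.commute)
  have c2: "c\<^sup>2 = a ^ (q + 1)"
    using N q_ge(2) unfolding c_def by (metis dvd_div_mult_self power_mult)
  have "c ^ q = ((a ^ (q + 1)) ^ q) ^ (q div 2)"
    unfolding c_def by (metis mult.commute power_mult)
  then have c: "c ^ q = c" unfolding N by (simp add: c_def)
  have c0: "c \<noteq> 0" using assms by (simp add: c_def)
  have "c ^ (q + 1) = a ^ (q + 1)"
    using c c2 by (simp add: power2_eq_square)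
  then have "(a / c) ^ (q + 1) = 1"
    using assms by (simp only: power_divide) simp
  then show ?thesis using that[of c "a / c"] c c0 by (simp add: K_def U_def)
qed

text \<open>Multiplication by the unitary part of \<open>a\<close> permutes \<open>U\<close>, so
  only \<open>c\<close> in \<open>K\<close> matters. For \<open>u\<close> in \<open>U\<close> the
  trace of \<open>c * u\<close> is the subfield trace of \<open>c * (u + 1 / u)\<close>: the point 1
  always counts, and the other points come in pairs over \<open>Z\<close>.\<close>

lemma card_U_tr_zero:
  assumes "a \<noteq> 0"
  shows "q + 2 \<le> 2 * 2 ^ m + 2 * card {u \<in> U. tr (4 * m) (a * u) = 0}"
proof -
  obtain c v where a: "a = c * v" and c: "c \<in> K" "c \<noteq> 0" and v: "v \<in> U"
    using polar_decomposition[OF assms] .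
  have "card {u \<in> U. tr (4 * m) (a * u) = 0} = card {u \<in> U. tr (4 * m) (c * u) = 0}"
    by (rule bij_betw_same_card[of "\<lambda>u. v * u"], rule bij_betw_byWitness[of _ "\<lambda>u. u / v"])
      (use v U_closed U_nonzero[OF v] in \<open>auto simp: a mult.assoc\<close>)
  also have "{u \<in> U. tr (4 * m) (c * u) = 0}
      = insert 1 {u \<in> U - {1}. tr (2 * m) (c * (u + 1 / u)) = 0}"
  proof -
    have "tr (4 * m) (c * u) = tr (2 * m) (c * (u + 1 / u))" if "u \<in> U" for u
      using c(1) U_power_q[OF that]
      by (simp add: tr_eq_trK power_mult_distrib K_def distrib_left)
    moreover from this[OF U_closed(1)] have "tr (4 * m) c = 0"
      using two_eq_0_CHAR_2[OF char] by simp
    ultimately show ?thesis using U_closed(1) by auto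
  qed
  also have "card \<dots> = 1 + 2 * card {z \<in> Z. tr (2 * m) (c * z) = 0}"
    using card_U_eq_card_Z[of "\<lambda>z. tr (2 * m) (c * z) = 0"] by simp
  finally show ?thesis using card_Z_trK_zero[OF c] by simp
qed

end

context zetterberg_field
begin

section \<open>Sums of few elements of the unit circle\<close>

text \<open>\<open>q\<close> is a power of 4, hence 1 modulo 3. This excludes elements of order 3
  from \<open>U\<close>.\<close>

lemma three_not_dvd: "\<not> 3 dvd q + 1"
proof -
  have "(4::nat) ^ m mod 3 = (4 mod 3) ^ m mod 3" by (rule power_mod[symmetric])
  then have "q mod 3 = 1" by (simp add: q_def power_mult)
  then show ?thesis by presburger
qed

lemma U_cube_eq_1:
  assumes "u \<in> U" "u ^ 3 = 1"
  shows "u = 1"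
proof -
  have "(q + 1) mod 3 = 1 \<or> (q + 1) mod 3 = 2" using three_not_dvd by presburger
  moreover have "u ^ ((q + 1) mod 3) = 1"
  proof -
    have "u ^ (q + 1) = u ^ (3 * ((q + 1) div 3) + (q + 1) mod 3)" by simp
    also have "\<dots> = u ^ ((q + 1) mod 3)"
      by (simp only: power_add power_mult assms(2) power_one mult_1_left)
    finally show ?thesis using assms(1) by (simp add: U_def)
  qed
  ultimately have "u = 1 \<or> u * u = 1" by (auto simp: power2_eq_square)
  then show ?thesis using assms(2) by (auto simp: power3_eq_cube)
qed

text \<open>The \<open>q\<close>-th power is additive and inverts the elements of
  \<open>U\<close>.\<close>

lemma inverse_sum_eq_0:
  assumes "V \<subseteq> U" "(\<Sum>u\<in>V. u) = 0"
  shows "(\<Sum>u\<in>V. 1 / u) = 0"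
proof -
  have "(\<Sum>u\<in>V. 1 / u) = (\<Sum>u\<in>V. u ^ q)"
    using assms(1) U_power_q by (intro sum.cong) auto
  also have "\<dots> = (\<Sum>u\<in>V. u) ^ q"
    by (induction V rule: infinite_finite_induct) (use q_ge in \<open>simp_all add: power_q_add power_0_left\<close>)
  finally show ?thesis using assms(2) q_ge by (simp add: power_0_left)
qed

text \<open>Eliminating \<open>w\<close> from the vanishing sums of the elements and of their
  inverses gives \<open>u^2 + u v + v^2 = 0\<close>, so \<open>u / v\<close> is a cube root of unity
  and hence 1.\<close>

lemma sum_three_nonzero:
  assumes "V \<subseteq> U" "card V = 3"
  shows "(\<Sum>u\<in>V. u) \<noteq> 0"
proof
  assume sum0: "(\<Sum>u\<in>V. u) = 0"
  obtain u v w where V: "V = {u, v, w}" and d: "u \<noteq> v" "v \<noteq> w" "u \<noteq> w"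
    using assms(2) card_3_iff by metis
  have U: "u \<in> U" "v \<in> U" "w \<in> U" using assms(1) V by auto
  then have nz: "u \<noteq> 0" "v \<noteq> 0" "w \<noteq> 0" using U_nonzero by auto
  have 1: "u + (v + w) = 0" using sum0 V d by simp
  have "1 / u + (1 / v + 1 / w) = 0"
    using inverse_sum_eq_0[OF assms(1) sum0] V d by simp
  then have 2: "v * w + (u * w + u * v) = 0" using nz by (simp add: field_simps)
  have w: "w = u + v" using 1 add_eq_0_iff_eq by (metis add.assoc)
  have "u * u + u * v + v * v = 0"
    using 2 two_eq_0_CHAR_2[OF char] unfolding w by (simp add: algebra_simps)
  then have "(u + v) * (u * u + u * v + v * v) = 0" by simp
  then have "u ^ 3 + v ^ 3 = 0"
    using two_eq_0_CHAR_2[OF char] by (simp add: algebra_simps power3_eq_cube)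
  then have "(u / v) ^ 3 = 1" using nz by (simp add: add_eq_0_iff_eq power_divide)
  then have "u / v = 1" using U_cube_eq_1 U_closed(3)[OF U(1,2)] by blast
  then show False using d nz by simp
qed

text \<open>The sums of the elements and of their inverses give \<open>t + u = v + w\<close> and
  \<open>t * u = v * w\<close>. Both pairs are then the roots of one quadratic polynomial, so
  \<open>t\<close> is \<open>v\<close> or \<open>w\<close>.\<close>

lemma sum_four_nonzero:
  assumes "V \<subseteq> U" "card V = 4"
  shows "(\<Sum>u\<in>V. u) \<noteq> 0"
proof
  assume sum0: "(\<Sum>u\<in>V. u) = 0"
  obtain t V' where V': "V = insert t V'" "t \<notin> V'" "card V' = 3"
    using assms(2) card_Suc_eq[of V 3] by auto
  obtain u v w where "V' = {u, v, w}" and "u \<noteq> v" "v \<noteq> w" "u \<noteq> w"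
    using V'(3) card_3_iff by metis
  then have V: "V = {t, u, v, w}" and d: "t \<noteq> u" "t \<noteq> v" "t \<noteq> w" "u \<noteq> v" "v \<noteq> w" "u \<noteq> w"
    using V' by auto
  have U: "t \<in> U" "u \<in> U" "v \<in> U" "w \<in> U" using assms(1) V by auto
  then have nz: "t \<noteq> 0" "u \<noteq> 0" "v \<noteq> 0" "w \<noteq> 0" using U_nonzero by auto
  have "t + u + (v + w) = 0" using sum0 V d by (simp add: add.assoc)
  then have 1: "t + u = v + w" by (simp only: add_eq_0_iff_eq)
  have "1 / t + 1 / u + (1 / v + 1 / w) = 0"
    using inverse_sum_eq_0[OF assms(1) sum0] V d by (simp add: add.assoc)
  then have "1 / t + 1 / u = 1 / v + 1 / w" by (simp only: add_eq_0_iff_eq)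
  moreover have "1 / t + 1 / u = (t + u) / (t * u)" "1 / v + 1 / w = (v + w) / (v * w)"
    using nz by (simp_all add: field_simps)
  moreover have "t + u \<noteq> 0" using d add_eq_0_iff_eq by blast
  ultimately have 2: "t * u = v * w" using 1 nz by (simp add: field_simps)
  have "(t - v) * (t - w) = t * (t + u - (v + w)) + (v * w - t * u)"
    by (simp add: algebra_simps)
  also have "\<dots> = 0" using 1 2 by simp
  finally show False using d by simp
qed

lemma sum_le_four_nonzero:
  assumes "V \<subseteq> U" "V \<noteq> {}" "card V \<le> 4"
  shows "(\<Sum>u\<in>V. u) \<noteq> 0"
proof -
  have "card V \<noteq> 0" using assms(2) by simp
  then consider "card V = 1" | "card V = 2" | "card V = 3" | "card V = 4"
    using assms(3) by linarith
  then show ?thesis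
  proof cases
    case 1
    then obtain u where "V = {u}" using card_1_singletonE by blast
    then show ?thesis using assms(1) U_nonzero by auto
  next
    case 2
    then obtain u v where "V = {u, v}" "u \<noteq> v" using card_2_iff by metis
    then show ?thesis by (simp add: add_eq_0_iff_eq)
  qed (use sum_three_nonzero sum_four_nonzero assms in auto)
qed

text \<open>By pigeonhole both \<open>z\<close> and \<open>z + 1\<close> are of the form \<open>u + 1 / u\<close> for some \<open>z\<close>.\<close>

lemma five_sum_eq_0:
  obtains V where "V \<subseteq> U" "card V = 5" "(\<Sum>u\<in>V. u) = 0"
proof -
  define Z' where "Z' = (\<lambda>z. z + 1) ` Z"
  \<comment> \<open>The trace of 1 is a sum of \<open>2 * m\<close> ones, hence 0.\<close>
  have one: "1 \<notin> Z" using trK_1 by (simp add: Z_def)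
  have "Z \<union> Z' \<subseteq> K - {0, 1}"
  proof
    fix x assume "x \<in> Z \<union> Z'"
    then consider "x \<in> Z" | y where "y \<in> Z" "x = y + 1" by (auto simp: Z'_def)
    then show "x \<in> K - {0, 1}"
    proof cases
      case 1
      then have "x \<noteq> 1" using one by blast
      then show ?thesis using 1 by (simp add: Z_def)
    next
      case 2
      then have "y \<noteq> 1" using one by blast
      then show ?thesis using 2 K_closed(3)[OF _ K_closed(2)] add_eq_0_iff_eq
        by (simp add: Z_def)
    qed
  qed
  then have "card (Z \<union> Z') \<le> card (K - {0, 1})" by (intro card_mono) auto
  also have "\<dots> = q - 2" using K_closed(1,2) card_K by (simp add: card_Diff_subset)
  finally have "card (Z \<union> Z') < q" using q_ge by linarith
  moreover have "card Z' = card Z" by (simp add: Z'_def card_image inj_on_def)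
  ultimately have "Z \<inter> Z' \<noteq> {}" using card_Z card_Un_disjoint[of Z Z'] by auto
  then obtain z where z: "z \<in> Z" "z + 1 \<in> Z" by (auto simp: Z'_def add.assoc)
  obtain u where u: "u \<in> U" "u \<noteq> 1" "z = u + 1 / u" using z(1) add_inverse_image by blast
  obtain v where v: "v \<in> U" "v \<noteq> 1" "z + 1 = v + 1 / v" using z(2) add_inverse_image by blast
  have nz: "u \<noteq> 0" "v \<noteq> 0" using u v U_nonzero by auto
  have "z \<noteq> 0" "z + 1 \<noteq> 0" using z by (auto simp: Z_def)
  then have "u \<noteq> 1 / u" "v \<noteq> 1 / v" using u v add_eq_0_iff_eq by metis+
  moreover have "z \<noteq> z + 1" by simp
  then have "u \<noteq> v" "u \<noteq> 1 / v" "1 / u \<noteq> v" "1 / u \<noteq> 1 / v"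
    using u(3) v(3) by (auto simp: add.commute)
  ultimately have "card {1, u, 1 / u, v, 1 / v} = 5"
    "(\<Sum>x\<in>{1, u, 1 / u, v, 1 / v}. x) = 1 + (z + (z + 1))"
    using u v nz by (auto simp: eq_divide_eq divide_eq_eq add.assoc)
  moreover have "1 + (z + (z + 1)) = 0"
    by (metis add.commute add.left_commute add_self add_0_right)
  moreover have "{1, u, 1 / u, v, 1 / v} \<subseteq> U" using u v U_closed by auto
  ultimately show ?thesis using that by metis
qed

lemma sum_\<theta>_image:
  assumes "S \<subseteq> {..<q + 1}"
  shows "(\<Sum>i\<in>S. \<theta> ^ i) = (\<Sum>u\<in>(\<lambda>i. \<theta> ^ i) ` S. u)" "card ((\<lambda>i. \<theta> ^ i) ` S) = card S"
    "(\<lambda>i. \<theta> ^ i) ` S \<subseteq> U"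
proof -
  have "inj_on (\<lambda>i. \<theta> ^ i) S" using inj_on_subset[OF inj_\<theta>] assms by (simp add: q_def)
  then show "(\<Sum>i\<in>S. \<theta> ^ i) = (\<Sum>u\<in>(\<lambda>i. \<theta> ^ i) ` S. u)"
    "card ((\<lambda>i. \<theta> ^ i) ` S) = card S"
    by (simp_all add: sum.reindex card_image)
  show "(\<lambda>i. \<theta> ^ i) ` S \<subseteq> U" using assms U_eq by auto
qed

lemma \<theta>_sum_nonzero:
  assumes "S \<subseteq> {..<q + 1}" "S \<noteq> {}" "card S \<le> 4"
  shows "(\<Sum>i\<in>S. \<theta> ^ i) \<noteq> 0"
  using sum_le_four_nonzero sum_\<theta>_image[OF assms(1)] assms(2,3) by simp

lemma \<theta>_five_sum:
  obtains S where "S \<subseteq> {..<q + 1}" "card S = 5" "(\<Sum>i\<in>S. \<theta> ^ i) = 0"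
proof -
  obtain V where V: "V \<subseteq> U" "card V = 5" "(\<Sum>u\<in>V. u) = 0" using five_sum_eq_0 .
  then obtain S where "S \<subseteq> {..<q + 1}" "V = (\<lambda>i. \<theta> ^ i) ` S"
    using U_eq subset_image_iff by metis
  then show ?thesis using that sum_\<theta>_image[of S] V by metis
qed

section \<open>Equidistribution of the trace form\<close>

definition \<chi> :: "'a \<Rightarrow> real" where
  "\<chi> x = (if tr (4 * m) x = 0 then 1 else -1)"

lemma \<chi>_add: "\<chi> (x + y) = \<chi> x * \<chi> y"
  using tr_01[of x] tr_01[of y] by (auto simp: \<chi>_def tr_add[OF char])

lemma \<chi>_sum: "\<chi> (\<Sum>i\<in>S. f i) = (\<Prod>i\<in>S. \<chi> (f i))"
  by (induction S rule: infinite_finite_induct) (simp_all add: \<chi>_add, simp_all add: \<chi>_def)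

lemma tr_nonzero: obtains x :: 'a where "tr (4 * m) x \<noteq> 0"
  using tr_nonzero_exists[of "UNIV :: 'a set" "4 * m"] m card_UNIV by auto

text \<open>Translation by an element of nonzero trace changes the sign of the full character
  sum.\<close>

lemma sum_\<chi>_mult:
  assumes "z \<noteq> 0"
  shows "(\<Sum>a\<in>UNIV. \<chi> (a * z)) = 0"
proof -
  obtain y :: 'a where y: "tr (4 * m) y \<noteq> 0" using tr_nonzero .
  have "(\<Sum>a\<in>UNIV. \<chi> (a * z)) = (\<Sum>a\<in>UNIV. \<chi> (a + y))"
    by (rule sum.reindex_bij_witness[of _ "\<lambda>a. (a + y) / z" "\<lambda>a. a * z - y"])
      (use assms in auto)
  also have "\<dots> = (\<Sum>a\<in>UNIV. \<chi> a) * \<chi> y" by (simp add: \<chi>_add sum_distrib_right)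
  also have "(\<Sum>a\<in>UNIV. \<chi> a) = (\<Sum>a\<in>UNIV. \<chi> (a * z))"
    by (rule sum.reindex_bij_witness[of _ "\<lambda>a. a * z" "\<lambda>a. a / z"]) (use assms in auto)
  finally show ?thesis using y by (simp add: \<chi>_def)
qed

text \<open>The indicator of the pattern is a product of factors
  \<open>(1 + \<epsilon> i * \<chi> (a * f i)) / 2\<close>. Expanding over subsets and summing over
  \<open>a\<close>, orthogonality kills every term but the empty one, since all nonempty subset sums
  are nonzero.\<close>

lemma card_tr_pattern:
  fixes f :: "'b \<Rightarrow> 'a"
  assumes "finite T" "\<And>S. S \<subseteq> T \<Longrightarrow> S \<noteq> {} \<Longrightarrow> (\<Sum>i\<in>S. f i) \<noteq> 0"
  shows "real (card {a. \<forall>i\<in>T. (tr (4 * m) (a * f i) = 0) = P i}) = 2 ^ (4 * m) / 2 ^ card T"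
proof -
  define \<epsilon> :: "_ \<Rightarrow> real" where "\<epsilon> i = (if P i then 1 else -1)" for i
  have ind: "(\<Prod>i\<in>T. 1 + \<epsilon> i * \<chi> (a * f i))
      = (if \<forall>i\<in>T. (tr (4 * m) (a * f i) = 0) = P i then 2 ^ card T else 0)" for a
  proof (cases "\<forall>i\<in>T. (tr (4 * m) (a * f i) = 0) = P i")
    case True
    then have "(\<Prod>i\<in>T. 1 + \<epsilon> i * \<chi> (a * f i)) = (\<Prod>i\<in>T. 2)"
      by (intro prod.cong) (auto simp: \<epsilon>_def \<chi>_def)
    then show ?thesis using True by simp
  next
    case False
    then obtain i where "i \<in> T" "(tr (4 * m) (a * f i) = 0) \<noteq> P i" by blast
    then have "1 + \<epsilon> i * \<chi> (a * f i) = 0" by (auto simp: \<epsilon>_def \<chi>_def)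
    then show ?thesis using False assms(1) \<open>i \<in> T\<close> by auto
  qed
  have "2 ^ card T * real (card {a. \<forall>i\<in>T. (tr (4 * m) (a * f i) = 0) = P i})
      = (\<Sum>a\<in>UNIV. \<Prod>i\<in>T. 1 + \<epsilon> i * \<chi> (a * f i))"
    unfolding ind by (simp add: sum.If_cases)
  also have "\<dots> = (\<Sum>a\<in>UNIV. \<Sum>S\<in>Pow T. (\<Prod>i\<in>S. \<epsilon> i) * \<chi> (a * (\<Sum>i\<in>S. f i)))"
  proof (intro sum.cong refl)
    fix a
    have "(\<Prod>i\<in>T. 1 + \<epsilon> i * \<chi> (a * f i)) = (\<Prod>i\<in>T. \<epsilon> i * \<chi> (a * f i) + 1)"
      by (simp add: add.commute)
    also have "\<dots> = (\<Sum>S\<in>Pow T. (\<Prod>i\<in>S. \<epsilon> i * \<chi> (a * f i)) * (\<Prod>i\<in>T - S. 1))"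
      by (rule prod_add[OF assms(1)])
    also have "\<dots> = (\<Sum>S\<in>Pow T. (\<Prod>i\<in>S. \<epsilon> i) * \<chi> (a * (\<Sum>i\<in>S. f i)))"
      by (simp add: prod.distrib sum_distrib_left \<chi>_sum)
    finally show "(\<Prod>i\<in>T. 1 + \<epsilon> i * \<chi> (a * f i)) = \<dots>" .
  qed
  also have "\<dots> = (\<Sum>S\<in>Pow T. (\<Prod>i\<in>S. \<epsilon> i) * (\<Sum>a\<in>UNIV. \<chi> (a * (\<Sum>i\<in>S. f i))))"
    by (subst sum.swap) (simp add: sum_distrib_left)
  also have "\<dots> = (\<Sum>S\<in>Pow T. if S = {} then 2 ^ (4 * m) else 0)"
  proof (intro sum.cong refl)
    fix S assume "S \<in> Pow T"
    then show "(\<Prod>i\<in>S. \<epsilon> i) * (\<Sum>a\<in>UNIV. \<chi> (a * (\<Sum>i\<in>S. f i))) = (if S = {} then 2 ^ (4 * m) else 0)"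
      using assms(2)[of S] sum_\<chi>_mult card_UNIV by (auto simp: \<chi>_def)
  qed
  also have "\<dots> = 2 ^ (4 * m)" using assms(1) by (simp add: sum.delta)
  finally show ?thesis by (simp add: field_simps)
qed

end

section \<open>The dual code\<close>

text \<open>As a constant, the inclusion of the binary field is not unfolded by the simplifier.\<close>

definition bit_embed :: "bit \<Rightarrow> 'a::comm_ring_1" where
  "bit_embed b = of_bit b"

lemma bit_embed_0_1 [simp]: "bit_embed 0 = 0" "bit_embed 1 = 1"
  by (simp_all add: bit_embed_def)

lemma bit_embed_add:
  "CHAR('a::comm_ring_1) = 2 \<Longrightarrow> (bit_embed (a + b) :: 'a) = bit_embed a + bit_embed b"
  by (cases a; cases b) (simp_all add: two_eq_0_CHAR_2)

lemma bit_embed_mult: "bit_embed (a * b) = bit_embed a * bit_embed b"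
  by (cases a; cases b) simp_all

lemma bit_embed_sum:
  assumes "CHAR('a::comm_ring_1) = 2"
  shows "(bit_embed (\<Sum>i\<in>A. f i) :: 'a) = (\<Sum>i\<in>A. bit_embed (f i))"
  by (induction A rule: infinite_finite_induct)
    (simp_all add: bit_embed_add[OF assms] del: add_bit_eq_xor)

definition bit_eval :: "'a::comm_ring_1 \<Rightarrow> bit poly \<Rightarrow> 'a" where
  "bit_eval x p = poly (map_poly bit_embed p) x"

lemma bit_eval_of_bit: "bit_eval x p = poly (map_poly of_bit p) x"
  by (simp add: bit_eval_def bit_embed_def[abs_def])

lemma degree_map_poly_bit_embed_le: "degree (map_poly bit_embed p) \<le> degree p"
  by (rule degree_le) (simp add: coeff_map_poly coeff_eq_0)

lemma bit_eval_0 [simp]: "bit_eval x 0 = 0"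
  by (simp add: bit_eval_def)

lemma bit_eval_pCons: "bit_eval x (pCons a p) = bit_embed a + x * bit_eval x p"
  by (simp add: bit_eval_def map_poly_pCons)

lemma bit_eval_monom: "bit_eval x (monom 1 n) = x ^ n"
  by (simp add: bit_eval_def map_poly_monom poly_monom)

lemma bit_eval_add:
  assumes "CHAR('a::comm_ring_1) = 2"
  shows "bit_eval (x::'a) (p + q) = bit_eval x p + bit_eval x q"
  by (induction p q rule: poly_induct2)
    (simp_all add: bit_eval_pCons bit_embed_add[OF assms] algebra_simps del: add_bit_eq_xor)

lemma bit_eval_sum:
  assumes "CHAR('a::comm_ring_1) = 2"
  shows "bit_eval (x::'a) (\<Sum>i\<in>A. f i) = (\<Sum>i\<in>A. bit_eval x (f i))"
  by (induction A rule: infinite_finite_induct) (simp_all add: bit_eval_add[OF assms])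

lemma bit_eval_diff:
  assumes "CHAR('a::comm_ring_1) = 2"
  shows "bit_eval (x::'a) (p - q) = bit_eval x p - bit_eval x q"
  using bit_eval_add[OF assms, of x "p - q" q] by simp

lemma bit_eval_smult: "bit_eval x (Polynomial.smult a p) = bit_embed a * bit_eval x p"
  by (cases a) simp_all

lemma bit_eval_mult:
  assumes "CHAR('a::comm_ring_1) = 2"
  shows "bit_eval (x::'a) (p * q) = bit_eval x p * bit_eval x q"
proof (induction p)
  case (pCons a p)
  have "bit_eval x (pCons a p * q) = bit_embed a * bit_eval x q + x * bit_eval x (p * q)"
    by (simp add: bit_eval_add[OF assms] bit_eval_smult bit_eval_pCons)
  then show ?case by (simp add: pCons.IH bit_eval_pCons algebra_simps)
qed simp

lemma bit_eval_altdef: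
  assumes "degree p < n"
  shows "bit_eval x p = (\<Sum>i<n. bit_embed (coeff p i) * x ^ i)"
proof -
  have "bit_eval x p = (\<Sum>i\<le>degree (map_poly bit_embed p :: 'a poly). bit_embed (coeff p i) * x ^ i)"
    by (simp add: bit_eval_def poly_altdef coeff_map_poly)
  also have "\<dots> = (\<Sum>i<n. bit_embed (coeff p i) * x ^ i)"
  proof (rule sum.mono_neutral_left)
    show "{..degree (map_poly bit_embed p :: 'a poly)} \<subseteq> {..<n}"
      using degree_map_poly_bit_embed_le[of p, where 'a = 'a] assms by (auto intro: le_less_trans)
    show "\<forall>i\<in>{..<n} - {..degree (map_poly bit_embed p :: 'a poly)}. bit_embed (coeff p i) * x ^ i = 0"
    proof
      fix i assume "i \<in> {..<n} - {..degree (map_poly bit_embed p :: 'a poly)}"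
      then have "coeff (map_poly bit_embed p) i = (0::'a)" by (intro coeff_eq_0) auto
      then show "bit_embed (coeff p i) * x ^ i = 0" by (simp add: coeff_map_poly)
    qed
  qed simp
  finally show ?thesis .
qed

text \<open>Squaring fixes binary coefficients; hence squares of roots are roots.\<close>

lemma bit_eval_power2:
  assumes "CHAR('a::comm_ring_1) = 2"
  shows "bit_eval ((x::'a)\<^sup>2) p = (bit_eval x p)\<^sup>2"
proof -
  have "(bit_embed b * x ^ i)\<^sup>2 = bit_embed b * (x\<^sup>2) ^ i" for b i
    by (cases b) (simp_all add: mult.commute flip: power_mult)
  then show ?thesis
    unfolding bit_eval_altdef[of p "Suc (degree p)", OF lessI] power2_sum_CHAR_2[OF assms] by simp
qed

lemma binary_min_poly_nonzero: "is_binary_min_poly x g \<Longrightarrow> g \<noteq> 0"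
  by (auto simp: is_binary_min_poly_def)

lemma binary_min_poly_dvd_iff:
  fixes x :: "'a::field"
  assumes char: "CHAR('a) = 2" and g: "is_binary_min_poly x g"
  shows "g dvd p \<longleftrightarrow> bit_eval x p = 0"
proof
  have g0: "bit_eval x g = 0" using g by (simp add: is_binary_min_poly_def bit_eval_of_bit)
  then show "g dvd p \<Longrightarrow> bit_eval x p = 0" by (auto simp: bit_eval_mult[OF char])
  assume p: "bit_eval x p = 0"
  have "p mod g = p - p div g * g" by (simp add: minus_div_mult_eq_mod)
  then have "bit_eval x (p mod g) = 0"
    by (simp only: bit_eval_diff[OF char] bit_eval_mult[OF char] g0 p) simp
  then have "p mod g = 0 \<or> degree g \<le> degree (p mod g)"
    using g by (auto simp: is_binary_min_poly_def bit_eval_of_bit)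
  then show "g dvd p"
    using degree_mod_less[OF binary_min_poly_nonzero[OF g], of p] by (auto simp: dvd_eq_mod_eq_0)
qed

text \<open>The modulus vanishes at \<open>x\<close>, so a congruence to a multiple of
  \<open>g\<close> forces the root \<open>x\<close>; conversely a root \<open>x\<close> makes
  \<open>g\<close> a divisor.\<close>

lemma cyclic_code_binary_min_poly:
  fixes x :: "'a::field"
  assumes char: "CHAR('a) = 2" and g: "is_binary_min_poly x g" and "x ^ n = 1"
  shows "cyclic_code n g = {vec n (coeff p) | p. degree p < n \<and> bit_eval x p = 0}"
proof -
  have "(\<exists>q. [p = g * q] (mod (monom 1 n - 1))) \<longleftrightarrow> bit_eval x p = 0" for p
  proof
    assume "\<exists>q. [p = g * q] (mod (monom 1 n - 1))"
    then obtain q where "monom 1 n - 1 dvd p - g * q" by (auto simp: cong_iff_dvd_diff)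
    then obtain k where "p - g * q = (monom 1 n - 1) * k" by auto
    then have "p = g * q + (monom 1 n - 1) * k" by (metis diff_add_cancel add.commute)
    moreover have "bit_eval x (monom 1 n - 1) = 0"
      using assms(3) bit_eval_monom[of x 0]
      by (simp add: bit_eval_diff[OF char] bit_eval_monom)
    moreover have "bit_eval x g = 0" using binary_min_poly_dvd_iff[OF char g, of g] by simp
    ultimately show "bit_eval x p = 0"
      by (simp only: bit_eval_add[OF char] bit_eval_mult[OF char]) simp
  next
    assume "bit_eval x p = 0"
    then obtain q where "p = g * q" using binary_min_poly_dvd_iff[OF char g] by auto
    then have "[p = g * q] (mod (monom 1 n - 1))" by simp
    then show "\<exists>q. [p = g * q] (mod (monom 1 n - 1))" ..
  qed
  then show ?thesis by (simp add: cyclic_code_def)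
qed

text \<open>Sets of exponents stand for binary coefficient vectors: the difference of the two
  polynomials is nonzero, has degree below \<open>N\<close> and vanishes at
  \<open>x\<close>.\<close>

lemma sum_powers_eq_imp_degree_less:
  fixes x :: "'a::field"
  assumes char: "CHAR('a) = 2" and g: "is_binary_min_poly x g"
    and S: "S \<subseteq> {..<N}" "T \<subseteq> {..<N}" "S \<noteq> T"
    and eq: "(\<Sum>i\<in>S. x ^ i) = (\<Sum>i\<in>T. x ^ i)"
  shows "degree g < N"
proof -
  define P where "P A = (\<Sum>i\<in>A. monom (1::bit) i)" for A
  have coeff: "coeff (P A) i = of_bool (i \<in> A)" if "A \<subseteq> {..<N}" for A i
    using finite_subset[OF that] by (simp add: P_def coeff_sum sum.delta)
  define p where "p = P S - P T"
  obtain i where i: "i \<in> S \<longleftrightarrow> i \<notin> T" using S(3) by blast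
  then have "coeff p i \<noteq> 0" using S by (auto simp: p_def coeff)
  then have "p \<noteq> 0" by auto
  moreover have "bit_eval x p = 0"
    using eq by (simp add: p_def P_def bit_eval_diff[OF char] bit_eval_sum[OF char] bit_eval_monom)
  ultimately have "degree g \<le> degree p"
    using g by (auto simp: is_binary_min_poly_def bit_eval_of_bit)
  also have "degree p < N"
  proof (rule ccontr)
    assume "\<not> degree p < N"
    then have "coeff p (degree p) = 0" using S by (auto simp: p_def coeff)
    then show False using \<open>p \<noteq> 0\<close> by simp
  qed
  finally show ?thesis .
qed

section \<open>Trace codewords, conjugates of \<open>\<theta>\<close> and the dual code\<close>

context zetterberg_field
begin

definition n :: nat where "n = q + 1"

definition codeword :: "'a \<Rightarrow> bit vec" where
  "codeword a = vec n (\<lambda>i. if tr (4 * m) (a * \<theta> ^ i) = 0 then 0 else 1)"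

lemma codeword_carrier: "codeword a \<in> carrier_vec n"
  by (simp add: codeword_def)

lemma codeword_nth: "i < n \<Longrightarrow> codeword a $ i = 0 \<longleftrightarrow> tr (4 * m) (a * \<theta> ^ i) = 0"
  by (simp add: codeword_def)

lemma bit_embed_codeword: "i < n \<Longrightarrow> bit_embed (codeword a $ i) = tr (4 * m) (a * \<theta> ^ i)"
  using tr_01[of "a * \<theta> ^ i"] by (auto simp: codeword_def)

text \<open>Ensures that the first \<open>4 * m\<close> positions, which determine a codeword,
  exist.\<close>

lemma four_m_le_q: "4 * m \<le> q"
proof -
  have "m + 1 \<le> 2 ^ m" using less_exp[of m] by linarith
  then have "(m + 1) * (m + 1) \<le> 2 ^ m * 2 ^ m" by (intro mult_le_mono)
  moreover have "2 ^ m * 2 ^ m = q" by (simp add: q_def mult_2 flip: power_add)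
  moreover have "4 * m \<le> (m + 1) * (m + 1)" by (cases m) auto
  ultimately show ?thesis by linarith
qed

lemma \<theta>_power_inj: "i < n \<Longrightarrow> j < n \<Longrightarrow> \<theta> ^ i = \<theta> ^ j \<Longrightarrow> i = j"
  using inj_\<theta> by (auto simp: inj_on_def n_def q_def)

text \<open>For \<open>d \<le> 2 * m\<close> the exponents 1 and \<open>2 ^ d\<close> are distinct
  and below \<open>n\<close>. For larger \<open>d\<close>, since the \<open>q\<close>-th power
  inverts \<open>\<theta>\<close>, equality would give \<open>\<theta> ^ (2 ^ e + 1) = 1\<close>
  with \<open>2 ^ e + 1 < n\<close>.\<close>

lemma \<theta>_conjugate_ne:
  assumes "0 < d" "d < 4 * m"
  shows "\<theta> ^ 2 ^ d \<noteq> \<theta>"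
proof
  assume eq: "\<theta> ^ 2 ^ d = \<theta>"
  show False
  proof (cases "d \<le> 2 * m")
    case True
    then have "2 ^ d \<le> q" unfolding q_def by (intro power_increasing) auto
    then have "(2::nat) ^ d = 1"
      using \<theta>_power_inj[of "2 ^ d" 1] eq q_ge by (simp add: n_def)
    then show False using assms by simp
  next
    case False
    define e where "e = d - 2 * m"
    have e: "d = 2 * m + e" "e < 2 * m" using False assms by (auto simp: e_def)
    have "\<theta> ^ q = 1 / \<theta>"
      using \<theta> \<theta>_nonzero by (simp add: q_def field_simps)
    then have "\<theta> ^ 2 ^ d = (1 / \<theta>) ^ 2 ^ e" unfolding e(1) power_add power_mult q_def by simp
    then have "\<theta> ^ (2 ^ e + 1) = \<theta> ^ 0" using eq \<theta>_nonzero by (simp add: field_simps)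
    moreover have "(2::nat) ^ e < q" unfolding q_def using e(2) by (intro power_strict_increasing) auto
    ultimately have "(2::nat) ^ e + 1 = 0" by (intro \<theta>_power_inj) (auto simp: n_def)
    then show False by simp
  qed
qed

lemma inj_on_\<theta>_conjugates: "inj_on (\<lambda>j. \<theta> ^ 2 ^ j) {..<4 * m}"
proof (rule linorder_inj_onI)
  fix j k :: nat assume jk: "j < k" "k \<in> {..<4 * m}"
  define d where "d = k - j"
  have k: "k = j + d" using jk by (simp add: d_def)
  have F: "\<theta> ^ 2 ^ (4 * m + i) = \<theta> ^ 2 ^ i" for i
    using power_card_UNIV[of \<theta>] by (simp only: power_add power_mult)
  show "\<theta> ^ 2 ^ j \<noteq> \<theta> ^ 2 ^ k"
  proof
    assume "\<theta> ^ 2 ^ j = \<theta> ^ 2 ^ k"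
    \<comment> \<open>Squaring \<open>4 * m - j\<close> times brings the left side back to
      \<open>\<theta>\<close>.\<close>
    then have "(\<theta> ^ 2 ^ j) ^ 2 ^ (4 * m - j) = (\<theta> ^ 2 ^ k) ^ 2 ^ (4 * m - j)" by simp
    then have "\<theta> ^ 2 ^ (4 * m + 0) = \<theta> ^ 2 ^ (4 * m + d)"
      using jk by (simp add: k add.commute flip: power_mult power_add)
    then have "\<theta> = \<theta> ^ 2 ^ d" unfolding F by simp
    moreover have "0 < d" "d < 4 * m" using jk by (auto simp: d_def)
    ultimately show False using \<theta>_conjugate_ne by metis
  qed
qed auto

context
  fixes g :: "bit poly"
  assumes g: "is_binary_min_poly \<theta> g"
begin

text \<open>From above by pigeonhole: there are more subset sums of \<open>4 * m + 1\<close> powers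
  than field elements. From below by the \<open>4 * m\<close> distinct conjugates, which are all
  roots.\<close>

lemma degree_g: "degree g = 4 * m"
proof (rule antisym)
  have "\<not> inj_on (\<lambda>S. \<Sum>i\<in>S. \<theta> ^ i) (Pow {..<4 * m + 1})"
  proof (rule pigeonhole)
    have "card ((\<lambda>S. \<Sum>i\<in>S. \<theta> ^ i) ` Pow {..<4 * m + 1}) \<le> CARD('a)"
      by (intro card_mono) auto
    also have "\<dots> < 2 * 2 ^ (4 * m)" by (simp add: card_UNIV)
    finally show "card ((\<lambda>S. \<Sum>i\<in>S. \<theta> ^ i) ` Pow {..<4 * m + 1}) < card (Pow {..<4 * m + 1})"
      by (simp add: card_UNIV card_Pow)
  qed
  then obtain S T where "S \<subseteq> {..<4 * m + 1}" "T \<subseteq> {..<4 * m + 1}" "S \<noteq> T"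
    "(\<Sum>i\<in>S. \<theta> ^ i) = (\<Sum>i\<in>T. \<theta> ^ i)"
    unfolding inj_on_def by blast
  then have "degree g < 4 * m + 1" by (rule sum_powers_eq_imp_degree_less[OF char g])
  then show "degree g \<le> 4 * m" by simp
  define P where "P = (map_poly bit_embed g :: 'a poly)"
  have "lead_coeff g = 1" using g by (simp add: is_binary_min_poly_def)
  then have "coeff P (degree g) = 1" by (simp add: P_def coeff_map_poly)
  then have P0: "P \<noteq> 0" by auto
  have "poly P (\<theta> ^ 2 ^ j) = 0" for j
  proof (induction j)
    case 0
    show ?case using binary_min_poly_dvd_iff[OF char g, of g] by (simp add: P_def bit_eval_def)
  next
    case (Suc j)
    have "\<theta> ^ 2 ^ Suc j = (\<theta> ^ 2 ^ j)\<^sup>2" by (metis power_Suc2 power_mult)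
    then show ?case
      using Suc bit_eval_power2[OF char, of "\<theta> ^ 2 ^ j" g] by (simp add: P_def bit_eval_def)
  qed
  then have "(\<lambda>j. \<theta> ^ 2 ^ j) ` {..<4 * m} \<subseteq> {x. poly P x = 0}" by auto
  then have "card ((\<lambda>j. \<theta> ^ 2 ^ j) ` {..<4 * m}) \<le> card {x. poly P x = 0}"
    by (intro card_mono) auto
  then have "4 * m \<le> card {x. poly P x = 0}"
    by (simp add: card_image[OF inj_on_\<theta>_conjugates])
  also have "\<dots> \<le> degree P" using card_poly_roots_bound[OF P0] .
  also have "\<dots> \<le> degree g" unfolding P_def by (rule degree_map_poly_bit_embed_le)
  finally show "4 * m \<le> degree g" .
qed

text \<open>The \<open>2 ^ (4 * m)\<close> subset sums are distinct by the degree of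
  \<open>g\<close>, so they fill the field.\<close>

lemma span_\<theta>: "\<exists>S\<subseteq>{..<4 * m}. z = (\<Sum>i\<in>S. \<theta> ^ i)"
proof -
  have "inj_on (\<lambda>S. \<Sum>i\<in>S. \<theta> ^ i) (Pow {..<4 * m})"
    using sum_powers_eq_imp_degree_less[OF char g, of _ "4 * m"] degree_g
    by (auto simp: inj_on_def)
  then have "card ((\<lambda>S. \<Sum>i\<in>S. \<theta> ^ i) ` Pow {..<4 * m}) = CARD('a)"
    by (simp add: card_image card_Pow card_UNIV)
  then have "(\<lambda>S. \<Sum>i\<in>S. \<theta> ^ i) ` Pow {..<4 * m} = UNIV"
    by (intro card_subset_eq) auto
  then show ?thesis by (metis (no_types, lifting) PowD UNIV_I imageE)
qed

text \<open>Nondegeneracy of the trace form: for \<open>a \<noteq> 0\<close> an element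
  \<open>y\<close> of nonzero trace is \<open>a\<close> times a sum of these powers.\<close>

lemma tr_\<theta>_powers_zero:
  assumes "\<And>i. i < 4 * m \<Longrightarrow> tr (4 * m) (a * \<theta> ^ i) = 0"
  shows "a = 0"
proof (rule ccontr)
  assume a: "a \<noteq> 0"
  obtain y :: 'a where y: "tr (4 * m) y \<noteq> 0"
    using tr_nonzero .
  obtain S where S: "S \<subseteq> {..<4 * m}" "y / a = (\<Sum>i\<in>S. \<theta> ^ i)" using span_\<theta> by blast
  have "y = (\<Sum>i\<in>S. a * \<theta> ^ i)" using a S(2) by (simp add: field_simps flip: sum_distrib_left)
  then have "tr (4 * m) y = (\<Sum>i\<in>S. tr (4 * m) (a * \<theta> ^ i))" by (simp add: tr_sum[OF char])
  also have "\<dots> = 0" using S(1) assms by (intro sum.neutral) auto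
  finally show False using y by simp
qed

lemma tr_\<theta>_powers_inj:
  assumes "\<And>i. i < 4 * m \<Longrightarrow> tr (4 * m) (a * \<theta> ^ i) = 0 \<longleftrightarrow> tr (4 * m) (b * \<theta> ^ i) = 0"
  shows "a = b"
proof -
  have "a + b = 0"
  proof (rule tr_\<theta>_powers_zero)
    fix i assume "i < 4 * m"
    from assms[OF this] show "tr (4 * m) ((a + b) * \<theta> ^ i) = 0"
      using tr_01[of "a * \<theta> ^ i"] tr_01[of "b * \<theta> ^ i"] two_eq_0_CHAR_2[OF char]
      by (auto simp: distrib_right tr_add[OF char])
  qed
  then show ?thesis by (simp add: add_eq_0_iff_eq)
qed

lemma inj_codeword: "inj codeword"
proof (rule injI)
  fix a b assume "codeword a = codeword b"
  then have "tr (4 * m) (a * \<theta> ^ i) = 0 \<longleftrightarrow> tr (4 * m) (b * \<theta> ^ i) = 0" if "i < 4 * m" for i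
    using codeword_nth[of i a] codeword_nth[of i b] four_m_le_q that by (simp add: n_def)
  then show "a = b" by (rule tr_\<theta>_powers_inj)
qed

text \<open>An injection of the field into the subsets of a set of size \<open>4 * m\<close> is onto
  by cardinality.\<close>

lemma tr_\<theta>_powers_surj:
  assumes "S \<subseteq> {..<4 * m}"
  obtains a where "\<And>i. i < 4 * m \<Longrightarrow> tr (4 * m) (a * \<theta> ^ i) \<noteq> 0 \<longleftrightarrow> i \<in> S"
proof -
  define f where "f a = {i. i < 4 * m \<and> tr (4 * m) (a * \<theta> ^ i) \<noteq> 0}" for a
  have "inj f"
    by (rule injI, rule tr_\<theta>_powers_inj) (auto simp: f_def set_eq_iff)
  then have "card (range f) = card (Pow {..<4 * m})"
    by (simp add: card_image card_UNIV card_Pow)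
  then have "range f = Pow {..<4 * m}" by (intro card_subset_eq) (auto simp: f_def)
  then obtain a where "f a = S" using assms by (metis (no_types, lifting) PowI imageE)
  then show ?thesis using that[of a] by (auto simp: f_def)
qed

text \<open>The shift of \<open>g\<close> by \<open>i - 4 * m\<close> is a code polynomial of degree
  \<open>i\<close> with leading coefficient 1. Orthogonality to it expresses \<open>w i\<close>
  through earlier entries, so a dual word is determined by its first \<open>4 * m\<close>
  entries.\<close>

lemma dual_recursion:
  assumes w: "\<And>p. degree p < n \<Longrightarrow> bit_eval \<theta> p = 0 \<Longrightarrow> (\<Sum>i<n. coeff p i * w i) = 0"
    and init: "\<And>i. i < 4 * m \<Longrightarrow> w i = 0" and "i < n"
  shows "w i = 0"
  using assms(3)
proof (induction i rule: less_induct)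
  case (less i)
  show ?case
  proof (cases "i < 4 * m")
    case False
    define p where "p = monom 1 (i - 4 * m) * g"
    have g0: "g \<noteq> 0" by (rule binary_min_poly_nonzero[OF g])
    have deg: "degree p = i"
      using False g0 by (simp add: p_def degree_mult_eq degree_monom_eq degree_g)
    have "p \<noteq> 0" using g0 by (simp add: p_def)
    then have lead: "coeff p i = 1" using deg leading_coeff_0_iff[of p] by simp
    have "bit_eval \<theta> p = 0"
      using binary_min_poly_dvd_iff[OF char g, of p] by (simp add: p_def)
    then have "0 = (\<Sum>l<n. coeff p l * w l)" using w deg less.prems by simp
    also have "\<dots> = coeff p i * w i + (\<Sum>l\<in>{..<n} - {i}. coeff p l * w l)"
      using less.prems by (intro sum.remove) auto
    also have "(\<Sum>l\<in>{..<n} - {i}. coeff p l * w l) = 0"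
    proof (rule sum.neutral, rule ballI)
      fix l assume l: "l \<in> {..<n} - {i}"
      show "coeff p l * w l = 0"
      proof (cases "l < i")
        case True
        then show ?thesis using less.IH l by simp
      next
        case False
        then have "coeff p l = 0" using l deg by (intro coeff_eq_0) auto
        then show ?thesis by simp
      qed
    qed
    finally show ?thesis using lead by simp
  qed (rule init)
qed

text \<open>By linearity the inner product is the trace of \<open>a * p(\<theta>)\<close>.\<close>

lemma codeword_orthogonal:
  assumes "degree p < n" "bit_eval \<theta> p = 0"
  shows "vec n (coeff p) \<bullet> codeword a = 0"
proof -
  have "(bit_embed (vec n (coeff p) \<bullet> codeword a) :: 'a)
      = (\<Sum>i\<in>{0..<n}. bit_embed (coeff p i) * tr (4 * m) (a * \<theta> ^ i))"
    unfolding scalar_prod_def bit_embed_sum[OF char] bit_embed_mult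
      carrier_vecD[OF codeword_carrier]
    by (intro sum.cong) (simp_all add: bit_embed_codeword)
  also have "\<dots> = (\<Sum>i<n. tr (4 * m) (a * (bit_embed (coeff p i) * \<theta> ^ i)))"
    unfolding atLeast0LessThan
  proof (intro sum.cong refl)
    fix i
    show "bit_embed (coeff p i) * tr (4 * m) (a * \<theta> ^ i)
        = tr (4 * m) (a * (bit_embed (coeff p i) * \<theta> ^ i))"
      by (cases "coeff p i") simp_all
  qed
  also have "\<dots> = tr (4 * m) (a * bit_eval \<theta> p)"
    unfolding bit_eval_altdef[OF assms(1)] sum_distrib_left tr_sum[OF char] ..
  finally show ?thesis using assms(2) by (cases "vec n (coeff p) \<bullet> codeword a") simp_all
qed

text \<open>For a dual word choose \<open>a\<close> so that its trace word agrees in the first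
  \<open>4 * m\<close> positions; the difference satisfies the recursion and therefore
  vanishes.\<close>

lemma dual_eq_range_codeword: "euclidean_dual n (cyclic_code n g) = range codeword"
proof -
  have C: "cyclic_code n g = {vec n (coeff p) | p. degree p < n \<and> bit_eval \<theta> p = 0}"
    using \<theta> by (intro cyclic_code_binary_min_poly[OF char g]) (simp add: n_def q_def)
  have "y \<in> range codeword" if y: "y \<in> carrier_vec n"
    and dual: "\<And>p. degree p < n \<Longrightarrow> bit_eval \<theta> p = 0 \<Longrightarrow> vec n (coeff p) \<bullet> y = 0" for y
  proof -
    obtain a where a: "\<And>i. i < 4 * m \<Longrightarrow> tr (4 * m) (a * \<theta> ^ i) \<noteq> 0 \<longleftrightarrow> i \<in> {i \<in> {..<4 * m}. y $ i \<noteq> 0}"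
      using tr_\<theta>_powers_surj[of "{i \<in> {..<4 * m}. y $ i \<noteq> 0}"] by blast
    have "y $ i - codeword a $ i = 0" if "i < n" for i
    proof (rule dual_recursion[OF _ _ that])
      fix p assume p: "degree p < n" "bit_eval \<theta> p = 0"
      have "(\<Sum>i<n. coeff p i * (y $ i - codeword a $ i))
          = vec n (coeff p) \<bullet> y - vec n (coeff p) \<bullet> codeword a"
        unfolding scalar_prod_def carrier_vecD[OF codeword_carrier] carrier_vecD[OF y]
          sum_subtractf[symmetric] atLeast0LessThan
        by (intro sum.cong) (simp_all only: right_diff_distrib lessThan_iff index_vec)
      also have "\<dots> = 0" using dual[OF p] codeword_orthogonal[OF p] by simp
      finally show "(\<Sum>i<n. coeff p i * (y $ i - codeword a $ i)) = 0" .
    next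
      fix i assume "i < 4 * m"
      then have "i < n" using four_m_le_q by (simp add: n_def)
      then have "y $ i \<noteq> 0 \<longleftrightarrow> codeword a $ i \<noteq> 0"
        using a[OF \<open>i < 4 * m\<close>] codeword_nth \<open>i < 4 * m\<close> by simp
      then show "y $ i - codeword a $ i = 0" by (cases "y $ i"; cases "codeword a $ i") auto
    qed
    then have "y $ i = codeword a $ i" if "i < n" for i
      using that by (simp only: right_minus_eq)
    then have "y = codeword a"
      using carrier_vecD[OF codeword_carrier] carrier_vecD[OF y] by (intro eq_vecI) simp_all
    then show ?thesis by simp
  qed
  then show ?thesis
    using codeword_carrier codeword_orthogonal unfolding euclidean_dual_def C by blast
qed

end

end

section \<open>Finite subfields as fixed points of a power map\<close>

lemma subfield_power_card:
  fixes S :: "'a::field set"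
  assumes S: "is_subfield S" "finite S" "x \<in> S"
  shows "x ^ card S = x"
proof (cases "x = 0")
  case True
  then have "card S \<noteq> 0" using S by auto
  then show ?thesis using True by (simp add: power_0_left)
next
  case False
  define P where "P = (\<Prod>y\<in>S - {0}. y)"
  have P: "P \<noteq> 0" using S(2) by (simp add: P_def)
  have "P = (\<Prod>y\<in>S - {0}. x * y)"
    unfolding P_def
    by (rule prod.reindex_bij_witness[of _ "\<lambda>y. x * y" "\<lambda>y. inverse x * y"])
      (use S False in \<open>auto simp: is_subfield_def mult.assoc[symmetric]\<close>)
  also have "\<dots> = x ^ (card S - 1) * P"
    using S(1,2) by (simp add: prod.distrib P_def is_subfield_def card_Diff_singleton)
  finally have "x ^ (card S - 1) = 1" using P by simp
  moreover have "card S > 0" using S(2,3) card_gt_0_iff by blast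
  then have "card S = Suc (card S - 1)" by simp
  ultimately show ?thesis by (metis mult_1_right power_Suc)
qed

text \<open>The elements of \<open>S\<close> are already as many roots of
  \<open>x ^ card S - x\<close> as its degree allows.\<close>

lemma subfield_eq_fixed_points:
  fixes S :: "'a::field set"
  assumes S: "is_subfield S" "finite S"
  shows "S = {x. x ^ card S = x}"
proof -
  have "0 \<in> S" "1 \<in> S" using S(1) by (auto simp: is_subfield_def)
  then have "{0, 1} \<subseteq> S" by simp
  from card_mono[OF S(2) this] have card: "card S > 1" by simp
  define p where "p = monom 1 (card S) + [:0, -1::'a:]"
  have deg: "degree p = card S"
    using card unfolding p_def by (subst degree_add_eq_left) (simp_all add: degree_monom_eq)
  then have "p \<noteq> 0" using card by auto
  have roots: "{x. x ^ card S = x} = {x. poly p x = 0}" by (auto simp: p_def poly_monom)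
  show ?thesis
  proof (rule card_seteq)
    show "finite {x::'a. x ^ card S = x}"
      unfolding roots by (rule poly_roots_finite[OF \<open>p \<noteq> 0\<close>])
    show "S \<subseteq> {x. x ^ card S = x}" using subfield_power_card[OF S] by auto
    show "card {x::'a. x ^ card S = x} \<le> card S"
      unfolding roots using card_poly_roots_bound[OF \<open>p \<noteq> 0\<close>] deg by simp
  qed
qed

section \<open>Strength and covering radius\<close>

context zetterberg_field
begin

context
  fixes g :: "bit poly"
  assumes g: "is_binary_min_poly \<theta> g"
begin

lemma card_range_codeword: "card (range codeword) = 2 ^ (4 * m)"
  using card_image[OF inj_codeword[OF g]] card_UNIV by simp

lemma range_codeword_orthogonal_array: "binary_orthogonal_array n 4 (range codeword)"
  unfolding binary_orthogonal_array_def
proof (intro conjI allI impI)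
  show "range codeword \<subseteq> carrier_vec n" using codeword_carrier by blast
  show "4 \<le> n" using q_ge by (simp add: n_def)
  fix T v assume T: "T \<subseteq> {..<n} \<and> card T = 4"
  have fin: "finite T" using T finite_subset by blast
  have "{c \<in> range codeword. \<forall>i\<in>T. c $ i = v i}
      = codeword ` {a. \<forall>i\<in>T. (tr (4 * m) (a * \<theta> ^ i) = 0) = (v i = 0)}"
  proof -
    have "codeword a $ i = v i \<longleftrightarrow> (tr (4 * m) (a * \<theta> ^ i) = 0) = (v i = 0)" if "i \<in> T" for a i
    proof -
      have "i < n" using that T by auto
      then show ?thesis using codeword_nth[of i a] by (cases "v i"; cases "codeword a $ i") auto
    qed
    then show ?thesis by auto
  qed
  then have "card {c \<in> range codeword. \<forall>i\<in>T. c $ i = v i}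
      = card {a. \<forall>i\<in>T. (tr (4 * m) (a * \<theta> ^ i) = 0) = (v i = 0)}"
    using card_image[OF inj_on_subset[OF inj_codeword[OF g] subset_UNIV]] by simp
  also have "real \<dots> = 2 ^ (4 * m) / 2 ^ card T"
  proof (rule card_tr_pattern[OF fin])
    fix S assume "S \<subseteq> T" "S \<noteq> {}"
    then show "(\<Sum>i\<in>S. \<theta> ^ i) \<noteq> 0"
      using T card_mono[OF fin \<open>S \<subseteq> T\<close>] by (intro \<theta>_sum_nonzero) (auto simp: n_def)
  qed
  finally show "real (card {c \<in> range codeword. \<forall>i\<in>T. c $ i = v i})
      = real (card (range codeword)) / 2 ^ 4"
    using T card_range_codeword by simp
qed

text \<open>Five columns sum to 0, so a pattern with a single 1 among them never occurs, whereas an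
  orthogonal array would contain it a positive number of times. These columns are completed to
  \<open>\<tau>\<close> columns.\<close>

lemma range_codeword_not_orthogonal_array:
  assumes "5 \<le> \<tau>"
  shows "\<not> binary_orthogonal_array n \<tau> (range codeword)"
proof
  assume oa: "binary_orthogonal_array n \<tau> (range codeword)"
  obtain D where D: "D \<subseteq> {..<n}" "card D = 5" "(\<Sum>i\<in>D. \<theta> ^ i) = 0"
    using \<theta>_five_sum by (auto simp: n_def)
  have fin: "finite D" using D(1) finite_subset by blast
  obtain d where d: "d \<in> D" using D(2) by fastforce
  have "\<tau> \<le> card {..<n}" using oa by (simp add: binary_orthogonal_array_def)
  then obtain T where T: "D \<subseteq> T" "T \<subseteq> {..<n}" "card T = \<tau>"
    using exists_subset_between[of D \<tau> "{..<n}"] D assms by auto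
  define v :: "nat \<Rightarrow> bit" where "v i = (if i = d then 1 else 0)" for i
  have "\<not> (\<forall>i\<in>T. codeword a $ i = v i)" for a
  proof
    assume c: "\<forall>i\<in>T. codeword a $ i = v i"
    have "tr (4 * m) (a * \<theta> ^ i) = (if i = d then 1 else 0)" if "i \<in> D" for i
    proof -
      have "i < n" "i \<in> T" using that D T by auto
      then show ?thesis using c codeword_nth[of i a] tr_01[of "a * \<theta> ^ i"] by (auto simp: v_def)
    qed
    then have "(\<Sum>i\<in>D. tr (4 * m) (a * \<theta> ^ i)) = (\<Sum>i\<in>D. if i = d then 1 else 0)"
      by (intro sum.cong) auto
    also have "\<dots> = 1" using fin d by simp
    also have "(\<Sum>i\<in>D. tr (4 * m) (a * \<theta> ^ i)) = tr (4 * m) (a * (\<Sum>i\<in>D. \<theta> ^ i))"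
      by (simp add: tr_sum[OF char] sum_distrib_left)
    finally show False using D(3) by simp
  qed
  then have "{c \<in> range codeword. \<forall>i\<in>T. c $ i = v i} = {}" by auto
  moreover have "real (card {c \<in> range codeword. \<forall>i\<in>T. c $ i = v i})
      = real (card (range codeword)) / 2 ^ \<tau>"
    using oa T(2,3) unfolding binary_orthogonal_array_def by blast
  ultimately have "real (card ({} :: bit vec set)) = real (card (range codeword)) / 2 ^ \<tau>"
    by (simp only:)
  then show False using card_range_codeword by simp
qed

lemma oa_strength_range_codeword: "oa_strength n (range codeword) = 4"
  unfolding oa_strength_def
proof (rule Max_eqI)
  have "{\<tau>. binary_orthogonal_array n \<tau> (range codeword)} \<subseteq> {..4}"
  proof
    fix \<tau> assume "\<tau> \<in> {\<tau>. binary_orthogonal_array n \<tau> (range codeword)}"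
    then show "\<tau> \<in> {..4}" using range_codeword_not_orthogonal_array[of \<tau>] by fastforce
  qed
  then show "finite {\<tau>. binary_orthogonal_array n \<tau> (range codeword)}"
    and "\<And>\<tau>. \<tau> \<in> {\<tau>. binary_orthogonal_array n \<tau> (range codeword)} \<Longrightarrow> \<tau> \<le> 4"
    using finite_subset by blast+
qed (simp add: range_codeword_orthogonal_array)

text \<open>The words differ exactly where the trace is 0, which for \<open>a \<noteq> 0\<close> is
  the count over \<open>U\<close>. The zero word is treated apart: its distance is
  \<open>n\<close>.\<close>

lemma hamming_dist_codeword_ones:
  "q + 2 \<le> 2 * 2 ^ m + 2 * hamming_dist n (codeword a) (vec n (\<lambda>_. 1))"
proof -
  have eq: "{i. i < n \<and> codeword a $ i \<noteq> vec n (\<lambda>_. 1) $ i}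
      = {i \<in> {..<n}. tr (4 * m) (a * \<theta> ^ i) = 0}"
    by (auto simp: codeword_def split: if_splits)
  show ?thesis
  proof (cases "a = 0")
    case True
    then have "hamming_dist n (codeword a) (vec n (\<lambda>_. 1)) = n"
      unfolding hamming_dist_def eq by simp
    then show ?thesis by (simp add: n_def)
  next
    case False
    have "{u \<in> U. tr (4 * m) (a * u) = 0}
        = (\<lambda>i. \<theta> ^ i) ` {i \<in> {..<n}. tr (4 * m) (a * \<theta> ^ i) = 0}"
      unfolding U_eq n_def by auto
    moreover have "inj_on (\<lambda>i. \<theta> ^ i) {i \<in> {..<n}. tr (4 * m) (a * \<theta> ^ i) = 0}"
      by (rule inj_onI) (auto intro: \<theta>_power_inj)
    ultimately have "hamming_dist n (codeword a) (vec n (\<lambda>_. 1)) = card {u \<in> U. tr (4 * m) (a * u) = 0}"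
      by (simp only: hamming_dist_def eq card_image)
    then show ?thesis using card_U_tr_zero[OF False] by simp
  qed
qed

lemma covering_radius_range_codeword:
  "real (covering_radius n (range codeword)) \<ge> 2 ^ (2 * m - 1) - 2 ^ m + 1"
proof -
  define \<rho> where "\<rho> y = Min ((\<lambda>x. hamming_dist n x y) ` range codeword)" for y
  define y1 :: "bit vec" where "y1 = vec n (\<lambda>_. 1)"
  have le_n: "hamming_dist n x y \<le> n" for x y
  proof -
    have "card {i. i < n \<and> x $ i \<noteq> y $ i} \<le> card {..<n}" by (intro card_mono) auto
    then show ?thesis by (simp add: hamming_dist_def)
  qed
  have fin: "finite ((\<lambda>x. hamming_dist n x y) ` range codeword)" for y by simp
  have "\<rho> y \<le> hamming_dist n (codeword 0) y" for y
    unfolding \<rho>_def by (intro Min_le fin imageI rangeI)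
  then have "\<rho> y \<le> n" for y using le_n le_trans by blast
  then have "\<rho> ` carrier_vec n \<subseteq> {..n}" by auto
  then have "finite (\<rho> ` carrier_vec n)" using finite_subset by blast
  then have "\<rho> y1 \<le> Max (\<rho> ` carrier_vec n)" by (rule Max_ge) (simp add: y1_def)
  then have le: "\<rho> y1 \<le> covering_radius n (range codeword)"
    unfolding covering_radius_def \<rho>_def[abs_def] .
  have "\<rho> y1 \<in> (\<lambda>x. hamming_dist n x y1) ` range codeword"
    unfolding \<rho>_def by (intro Min_in fin) simp
  then obtain a where "\<rho> y1 = hamming_dist n (codeword a) y1" by auto
  then have "q + 2 \<le> 2 * 2 ^ m + 2 * covering_radius n (range codeword)"
    using hamming_dist_codeword_ones[of a] le unfolding y1_def by linarith
  then have "real q + 2 \<le> 2 * 2 ^ m + 2 * real (covering_radius n (range codeword))"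
    by (metis (mono_tags, lifting) of_nat_add of_nat_le_iff of_nat_mult of_nat_numeral of_nat_power)
  moreover have "real q = 2 * 2 ^ (2 * m - 1)"
  proof -
    have "Suc (2 * m - 1) = 2 * m" using m by simp
    then have "real q = 2 ^ Suc (2 * m - 1)" by (simp only: q_def of_nat_power of_nat_numeral)
    then show ?thesis by (simp only: power_Suc)
  qed
  ultimately show ?thesis by linarith
qed

end

end

theorem theorem6p10:
  fixes m n :: nat
    and \<theta> :: "'a::field"
    and K :: "'a set"
    and g :: "bit poly"
    and \<C> \<O> :: "bit vec set"
  assumes "m \<ge> 2"
    and "n = 2 ^ (2 * m) + 1"
    and "CARD('a) = 2 ^ (4 * m)"
    and "is_subfield K"
    and "card K = 2 ^ (2 * m)"
    and "\<theta> \<notin> K"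
    and "has_mult_order \<theta> (2 ^ (2 * m) + 1)"
    and "is_binary_min_poly \<theta> g"
    and "\<C> = cyclic_code n g"
    and "\<O> = euclidean_dual n \<C>"
  shows "binary_orthogonal_array n 4 \<O>
       \<and> card \<O> = 2 ^ (4 * m)
       \<and> oa_strength n \<O> = 4
       \<and> real (covering_radius n \<O>) \<ge> 2 ^ (2 * m - 1) - 2 ^ m + 1"
proof -
  have fin: "finite (UNIV :: 'a set)" using assms(3) by (intro card_ge_0_finite) simp
  \<comment> \<open>There is only one subfield of this size, the set of fixed points of the
    \<open>q\<close>-th power; this is the form in which the locale refers to it.\<close>
  have K: "K = {x. x ^ 2 ^ (2 * m) = x}"
    using subfield_eq_fixed_points[OF assms(4) finite_subset[OF subset_UNIV fin]]
    unfolding assms(5) .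
  interpret zetterberg_field m \<theta>
  proof
    show "m \<ge> 1" "CARD('a) = 2 ^ (4 * m)" using assms(1,3) by simp_all
    show "x ^ 2 ^ (4 * m) = x" for x :: 'a
      using subfield_power_card[of "UNIV :: 'a set" x] fin assms(3) by (simp add: is_subfield_def)
    show "card {x::'a. x ^ 2 ^ (2 * m) = x} = 2 ^ (2 * m)"
      unfolding K[symmetric] by (rule assms(5))
    show \<theta>: "\<theta> ^ (2 ^ (2 * m) + 1) = 1" using assms(7) by (simp add: has_mult_order_def)
    show "inj_on (\<lambda>i. \<theta> ^ i) {..<2 ^ (2 * m) + 1}"
    \<comment> \<open>Equal powers would give \<open>\<theta> ^ (j - i) = 1\<close> with a positive
      exponent below the order.\<close>
    proof (rule linorder_inj_onI)
      fix i j :: nat assume ij: "i < j" "j \<in> {..<2 ^ (2 * m) + 1}"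
      have "\<theta> \<noteq> 0" using \<theta> by auto
      then have "\<theta> ^ i = \<theta> ^ j \<Longrightarrow> \<theta> ^ (j - i) = 1"
        using ij by (simp add: power_diff)
      moreover have "\<theta> ^ (j - i) \<noteq> 1" using assms(7) ij by (auto simp: has_mult_order_def)
      ultimately show "\<theta> ^ i \<noteq> \<theta> ^ j" by blast
    qed auto
  qed
  have n: "n = zetterberg_field.n m" unfolding n_def q_def assms(2) ..
  have O: "\<O> = range codeword"
    unfolding assms(9,10) n by (rule dual_eq_range_codeword[OF assms(8)])
  show ?thesis
    unfolding O n
    by (intro conjI range_codeword_orthogonal_array[OF assms(8)] card_range_codeword[OF assms(8)]
        oa_strength_range_codeword[OF assms(8)] covering_radius_range_codeword[OF assms(8)])
qed

end
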